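(* There exist a recognizable and primitive directive sequence $\boldsymbol\tau = (\tau_n \colon \mathcal A_{n+1}^* \to \mathcal A_n^* )_{n\geq0}$ and an eigenvalue $\alpha$ of $X_{\boldsymbol\tau}$ such that, for any choice of letter-coboundaries $c_n \colon \mathcal A_n^* \to \mathbb R$ in $X_{\boldsymbol\tau}^{(n)}$, for $n \geq 0$, $$\liminf_{n\to\infty}\ \max_{a\in\mathcal A_n} \|c_n(a) - \alpha\, h_n(a)\| > 0.$$ In particular, for this $\boldsymbol\tau$ and $\alpha$, none of the following holds: (i) there are $n\ge0$ and a letter-coboundary $c_n$ in $X^{(n)}_{\boldsymbol\tau}$ such that $\sup\{\|c_n(\tau_{n,m}(u))-\alpha h_m(u)\|:u\in\mathcal L(X^{(m)}_{\boldsymbol\tau})\}\to0$ as $m\to\infty$; (ii) there are $n\ge0$ and a letter-coboundary $c_n$ in $X^{(n)}_{\boldsymbol\tau}$ such that the monoid morphism $\gamma_n:\mathcal A_n^*\to(\mathbb R,+)$ with $\gamma_n(a)=\{c_n(a)-\alpha h_n(a)\}$ for $a\in\mathcal A_n$ satisfies $\sup\{|\gamma_n(\tau_{n,m}(u))|:u\in\mathcal L(X^{(m)}_{\boldsymbol\tau})\}\to0$ as $m\to\infty$; (iii) there are letter-coboundaries $c_n$ in $X^{(n)}_{\boldsymbol\tau}$, $n\ge0$, such that $\sum_{n\ge0}\max\{\|c_n(u)-\alpha h_n(u)\|:a\in\mathcal A_{n+2},\ u\text{ a prefix of }\tau_{n,n+2}(a)\}<\infty$.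
   Context: Alphabets are finite sets with at least two elements. $\mathcal A^*$ is the free monoid of finite words over $\mathcal A$ and $|w|$ is the length of $w$. $S$ is the shift map $S((x_k)_k)=(x_{k+1})_k$ on $\mathcal A^{\mathbb Z}$; $\mathcal L(X)$ is the set of finite words occurring in points of a subshift $X$. A substitution $\tau:\mathcal A^*\to\mathcal B^*$ is a monoid morphism such that $\tau(a)$ is non-empty for every $a\in\mathcal A$ and every $b\in\mathcal B$ occurs in some $\tau(a)$; it acts on $x\in\mathcal A^{\mathbb Z}$ by concatenation, with $\tau(x_0)$ starting at coordinate $0$. A directive sequence $\boldsymbol\tau=(\tau_n)_{n\ge0}$ consists of substitutions $\tau_n:\mathcal A_{n+1}^*\to\mathcal A_n^*$. Put $\tau_{n,m}=\tau_n\circ\cdots\circ\tau_{m-1}$ for $m>n$. $X^{(n)}_{\boldsymbol\tau}$ is the set of $x\in\mathcal A_n^{\mathbb Z}$ such that every finite factor of $x$ occurs in $\tau_{n,m}(a)$ for some $m>n$ and $a\in\mathcal A_m$; $X_{\boldsymbol\tau}=X^{(0)}_{\boldsymbol\tau}$. Heights: $h_n(u)=|\tau_{0,n}(u)|$ for $u\in\mathcal A_n^*$, $n\ge1$, and $h_0(u)=|u|$. $\boldsymbol\tau$ is primitive if for every $n$ there is $m>n$ such that every letter of $\mathcal A_n$ occurs in $\tau_{n,m}(a)$ for every $a\in\mathcal A_m$. It is recognizable if, for every $n\ge1$, the sets $S^kB_n(a)$ ($a\in\mathcal A_n$, $0\le k<h_n(a)$) are pairwise disjoint, where $B_n(a)=\{\tau_{0,n}(x):x\in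 X^{(n)}_{\boldsymbol\tau},\ x_0=a\}$. A return word to a letter $a$ in a subshift $Y\subseteq\mathcal A^{\mathbb Z}$ is a word $w$ such that $wa\in\mathcal L(Y)$ and $wa$ contains exactly two occurrences of $a$, one as a prefix and one as a suffix. A letter-coboundary in $Y$ is a monoid morphism $c:\mathcal A^*\to(\mathbb R,+)$ such that $c(w)=0$ for every $a\in\mathcal A$ and every return word $w$ to $a$ in $Y$. A real number $\alpha$ is an eigenvalue (meaning continuous additive eigenvalue) of a subshift $X$ if there is a continuous $g:X\to\mathbb R/\mathbb Z$ with $g(Sx)=g(x)+\alpha \pmod{\mathbb Z}$ for all $x\in X$. For $x\in\mathbb R$, $\|x\|$ is the distance from $x$ to the nearest integer, and $\{x\}$ is the unique element of $[-1/2,1/2)$ such that $x-\{x\}$ is an integer. *)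

theory Defs
  imports "HOL-Analysis.Analysis" "HOL-Library.Sublist" "HOL-Library.Disjoint_Sets"
begin

quotient_type RmodZ = real / "\<lambda>x y. x - y \<in> \<int>"
  morphisms rep_RmodZ mod_Z
proof (rule equivpI)
  show "reflp (\<lambda>x y :: real. x - y \<in> \<int>)"
    by (auto simp: reflp_def)
  show "symp (\<lambda>x y :: real. x - y \<in> \<int>)"
    by (auto simp: symp_def) (metis Ints_minus minus_diff_eq)
  show "transp (\<lambda>x y :: real. x - y \<in> \<int>)"
    by (auto simp: transp_def) (metis Ints_add diff_add_cancel add_diff_eq)
qed

instantiation RmodZ :: ab_group_add
begin

lift_definition zero_RmodZ :: RmodZ is "0 :: real" .

lift_definition plus_RmodZ :: "RmodZ \<Rightarrow> RmodZ \<Rightarrow> RmodZ" is "(+) :: real \<Rightarrow> real \<Rightarrow> real"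
  by (metis Ints_add add_diff_add)

lift_definition uminus_RmodZ :: "RmodZ \<Rightarrow> RmodZ" is "uminus :: real \<Rightarrow> real"
  by (metis Ints_minus minus_diff_minus)

lift_definition minus_RmodZ :: "RmodZ \<Rightarrow> RmodZ \<Rightarrow> RmodZ" is "(-) :: real \<Rightarrow> real \<Rightarrow> real"
proof -
  fix a b c d :: real
  assume "a - b \<in> \<int>" "c - d \<in> \<int>"
  then have "(a - b) - (c - d) \<in> \<int>" by (rule Ints_diff)
  then show "(a - c) - (b - d) \<in> \<int>" by (simp add: algebra_simps)
qed

instance
  by standard (transfer; simp)+

end

instantiation RmodZ :: topological_space
begin

definition open_RmodZ :: "RmodZ set \<Rightarrow> bool" where
  "open_RmodZ U \<longleftrightarrow> open (mod_Z -` U)"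

instance
proof
  show "open (UNIV :: RmodZ set)"
    by (simp add: open_RmodZ_def)
next
  fix S T :: "RmodZ set"
  assume "open S" "open T"
  then show "open (S \<inter> T)"
    by (simp add: open_RmodZ_def open_Int vimage_Int)
next
  fix K :: "RmodZ set set"
  assume "\<forall>S\<in>K. open S"
  then show "open (\<Union>K)"
    by (auto simp: open_RmodZ_def vimage_Union)
qed

end

definition dist_int :: "real \<Rightarrow> real" where
  "dist_int x = infdist x \<int>"

text \<open>The representative of \<open>x\<close> modulo 1 in \<open>[-1/2, 1/2)\<close> (not the usual fractional part).\<close>

definition centered_frac :: "real \<Rightarrow> real" where
  "centered_frac x = (THE y. y \<in> {-1/2..<1/2} \<and> x - y \<in> \<int>)"

definition alphabet :: "'a set \<Rightarrow> bool" where
  "alphabet A \<longleftrightarrow> finite A \<and> card A \<ge> 2"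

definition shift :: "(int \<Rightarrow> 'a) \<Rightarrow> int \<Rightarrow> 'a" where
  "shift x = (\<lambda>k. x (k + 1))"

definition factor_at :: "(int \<Rightarrow> 'a) \<Rightarrow> int \<Rightarrow> nat \<Rightarrow> 'a list" where
  "factor_at x i l = map (\<lambda>j. x (i + int j)) [0..<l]"

definition lang :: "(int \<Rightarrow> 'a) set \<Rightarrow> 'a list set" where
  "lang X = {factor_at x i l | x i l. x \<in> X}"

definition return_word :: "(int \<Rightarrow> 'a) set \<Rightarrow> 'a \<Rightarrow> 'a list \<Rightarrow> bool" where
  "return_word Y a w \<longleftrightarrow> w @ [a] \<in> lang Y \<and> count_list (w @ [a]) a = 2
     \<and> prefix [a] (w @ [a]) \<and> suffix [a] (w @ [a])"

text \<open>Morphisms defined on the free monoid over \<open>A\<close> are functions on lists of which only the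
  values on \<^term>\<open>lists A\<close> are relevant.\<close>

definition letter_coboundary ::
  "'a set \<Rightarrow> (int \<Rightarrow> 'a) set \<Rightarrow> ('a list \<Rightarrow> real) \<Rightarrow> bool" where
  "letter_coboundary A Y c \<longleftrightarrow>
     c [] = 0 \<and> (\<forall>u\<in>lists A. \<forall>v\<in>lists A. c (u @ v) = c u + c v)
     \<and> (\<forall>a\<in>A. \<forall>w. return_word Y a w \<longrightarrow> c w = 0)"

text \<open>Continuity refers to the product topology on \<^typ>\<open>int \<Rightarrow> 'a\<close> with \<^typ>\<open>'a\<close> discrete.\<close>

definition eigenvalue :: "(int \<Rightarrow> 'a::discrete_topology) set \<Rightarrow> real \<Rightarrow> bool" where
  "eigenvalue X \<alpha> \<longleftrightarrow>
     (\<exists>g :: (int \<Rightarrow> 'a) \<Rightarrow> RmodZ. continuous_on X g \<and> (\<forall>x\<in>X. g (shift x) = g x + mod_Z \<alpha>))"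

definition substitution :: "'a set \<Rightarrow> 'b set \<Rightarrow> ('a list \<Rightarrow> 'b list) \<Rightarrow> bool" where
  "substitution A B \<sigma> \<longleftrightarrow>
     \<sigma> ` lists A \<subseteq> lists B
     \<and> \<sigma> [] = [] \<and> (\<forall>u\<in>lists A. \<forall>v\<in>lists A. \<sigma> (u @ v) = \<sigma> u @ \<sigma> v)
     \<and> (\<forall>a\<in>A. \<sigma> [a] \<noteq> []) \<and> (\<forall>b\<in>B. \<exists>a\<in>A. b \<in> set (\<sigma> [a]))"

text \<open>\<open>cut_pos \<sigma> x k\<close> is the coordinate at which the block \<open>\<sigma> [x k]\<close> starts in the image of \<open>x\<close>,
  the block of \<open>x 0\<close> starting at coordinate 0. In \<open>subst_biinf\<close> the index \<open>k\<close> of the block that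
  covers coordinate \<open>j\<close> is unique as soon as all blocks \<open>\<sigma> [x k]\<close> are non-empty.\<close>

definition cut_pos :: "('a list \<Rightarrow> 'b list) \<Rightarrow> (int \<Rightarrow> 'a) \<Rightarrow> int \<Rightarrow> int" where
  "cut_pos \<sigma> x k =
     (if 0 \<le> k then (\<Sum>i\<in>{0..<k}. int (length (\<sigma> [x i])))
      else - (\<Sum>i\<in>{k..<0}. int (length (\<sigma> [x i]))))"

definition subst_biinf :: "('a list \<Rightarrow> 'b list) \<Rightarrow> (int \<Rightarrow> 'a) \<Rightarrow> int \<Rightarrow> 'b" where
  "subst_biinf \<sigma> x = (\<lambda>j.
     let k = (THE k. cut_pos \<sigma> x k \<le> j \<and> j < cut_pos \<sigma> x (k + 1))
     in \<sigma> [x k] ! nat (j - cut_pos \<sigma> x k))"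

text \<open>A directive sequence is given by its alphabets \<open>A n\<close> and its substitutions
  \<open>\<tau> n\<close> from words over \<open>A (Suc n)\<close> to words over \<open>A n\<close>.\<close>

definition directive_sequence ::
  "(nat \<Rightarrow> 'a set) \<Rightarrow> (nat \<Rightarrow> 'a list \<Rightarrow> 'a list) \<Rightarrow> bool" where
  "directive_sequence A \<tau> \<longleftrightarrow>
     (\<forall>n. alphabet (A n)) \<and> (\<forall>n. substitution (A (Suc n)) (A n) (\<tau> n))"

text \<open>The composition \<open>\<tau> n \<circ> \<dots> \<circ> \<tau> (m - 1)\<close>; it is the identity for \<open>m = n\<close>.\<close>

definition tau_comp :: "(nat \<Rightarrow> 'a list \<Rightarrow> 'a list) \<Rightarrow> nat \<Rightarrow> nat \<Rightarrow> 'a list \<Rightarrow> 'a list" where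
  "tau_comp \<tau> n m = foldr (\<circ>) (map \<tau> [n..<m]) id"

definition level_shift ::
  "(nat \<Rightarrow> 'a set) \<Rightarrow> (nat \<Rightarrow> 'a list \<Rightarrow> 'a list) \<Rightarrow> nat \<Rightarrow> (int \<Rightarrow> 'a) set" where
  "level_shift A \<tau> n =
     {x. (\<forall>k. x k \<in> A n)
       \<and> (\<forall>i l. \<exists>m>n. \<exists>a\<in>A m. sublist (factor_at x i l) (tau_comp \<tau> n m [a]))}"

definition height :: "(nat \<Rightarrow> 'a list \<Rightarrow> 'a list) \<Rightarrow> nat \<Rightarrow> 'a list \<Rightarrow> nat" where
  "height \<tau> n u = length (tau_comp \<tau> 0 n u)"

definition primitive_seq ::
  "(nat \<Rightarrow> 'a set) \<Rightarrow> (nat \<Rightarrow> 'a list \<Rightarrow> 'a list) \<Rightarrow> bool" where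
  "primitive_seq A \<tau> \<longleftrightarrow>
     (\<forall>n. \<exists>m>n. \<forall>b\<in>A n. \<forall>a\<in>A m. b \<in> set (tau_comp \<tau> n m [a]))"

definition base ::
  "(nat \<Rightarrow> 'a set) \<Rightarrow> (nat \<Rightarrow> 'a list \<Rightarrow> 'a list) \<Rightarrow> nat \<Rightarrow> 'a \<Rightarrow> (int \<Rightarrow> 'a) set" where
  "base A \<tau> n a = {subst_biinf (tau_comp \<tau> 0 n) x | x. x \<in> level_shift A \<tau> n \<and> x 0 = a}"

definition recognizable_seq ::
  "(nat \<Rightarrow> 'a set) \<Rightarrow> (nat \<Rightarrow> 'a list \<Rightarrow> 'a list) \<Rightarrow> bool" where
  "recognizable_seq A \<tau> \<longleftrightarrow>
     (\<forall>n\<ge>1. disjoint_family_on (\<lambda>(a, k). (shift ^^ k) ` base A \<tau> n a)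
               {(a, k). a \<in> A n \<and> k < height \<tau> n [a]})"

definition frac_morphism ::
  "(nat \<Rightarrow> 'a list \<Rightarrow> 'a list) \<Rightarrow> real \<Rightarrow> nat \<Rightarrow> ('a list \<Rightarrow> real) \<Rightarrow> 'a list \<Rightarrow> real" where
  "frac_morphism \<tau> \<alpha> n c u =
     (\<Sum>a\<leftarrow>u. centered_frac (c [a] - \<alpha> * real (height \<tau> n [a])))"

end

theory Submission
  imports Defs "HOL-Number_Theory.Cong"
begin

text \<open>
  Why the theorem is true. A continuous eigenfunction \<open>g\<close> of an \<open>S\<close>-adic subshift is almost constant
  on the base \<open>B\<^sub>n(a)\<close> of each tower of level \<open>n\<close>, so it has an approximate value
  \<open>\<theta>\<^sub>n(a)\<close> in \<open>\<real>/\<int>\<close> there, and \<open>\<theta>\<^sub>n(b) - \<theta>\<^sub>n(a)\<close> is close to \<open>\<alpha> h\<^sub>n(a)\<close> whenever \<open>ab\<close> occurs at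
  level \<open>n\<close>. A letter-coboundary has the same form with an exact potential \<open>\<rho>\<close> in place of \<open>\<theta>\<^sub>n\<close>:
  \<open>\<rho>(b) - \<rho>(a) = c(a)\<close>. Two successors of the same letter have nearly the same \<open>\<theta>\<^sub>n\<close> but exactly
  the same \<open>\<rho>\<close>. If the alphabets grow, a long chain of such small discrepancies can go all the way
  round the circle. Then \<open>\<rho>\<close> is forced to be constant and \<open>c\<close> to vanish, although the
  values \<open>\<theta>\<^sub>n\<close> are spread over the circle and \<open>\<alpha> h\<^sub>n(a)\<close> is far from every integer.

  The example realizes this with substitutions of constant length, so that \<open>h\<^sub>n\<close> takes one value on
  all letters of level \<open>n\<close>. The alphabet of level \<open>n\<close> is \<open>\<int>/k\<^sub>n\<int>\<close> with \<open>k\<^sub>n = 2\<^bsup>n+2\<^esup>\<close>, the letter \<open>b\<close>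
  standing for the angle \<open>b/k\<^sub>n\<close>. Inside the image of a letter the angle is rotated at each step by
  \<open>p\<^sub>n/k\<^sub>n\<close>, where \<open>p\<^sub>n = k\<^sub>n/2 - 1\<close>, except that the first letter is moved by one or two units
  (\<open>image_letter\<close>). The images have length \<open>k\<^sub>n + 1\<close>, and \<open>\<alpha>\<close> is chosen so that \<open>\<alpha> h\<^sub>n\<close> equals
  \<open>p\<^sub>n/k\<^sub>n\<close> modulo 1 up to a tiny error (\<open>alpha_width\<close>), hence lies between \<open>1/4\<close> and \<open>1/2\<close> modulo 1
  (\<open>dist_int_alpha_width\<close>). The moved first letter serves several purposes at once. It marks the
  beginning of an image and records the parity of its preimage, which gives recognizability
  (\<open>local_recognizability\<close>). And it makes both \<open>q + p\<^sub>n - 1\<close> and \<open>q + p\<^sub>n\<close> successors of every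
  letter \<open>q\<close>, so \<open>\<rho>\<close> is constant and every letter-coboundary of every level is zero
  (\<open>letter_coboundary_eq_0\<close>). Primitivity holds because \<open>p\<^sub>n\<close> is prime to \<open>k\<^sub>n\<close>: each image contains
  all letters.

  The number \<open>\<alpha>\<close> is an eigenvalue because passing from level \<open>n + 1\<close> to level \<open>n\<close> changes the
  angle of a tower by at most \<open>2/k\<^sub>n\<close> (\<open>angle_step\<close>), and these errors are summable. A window
  of \<open>y\<close> of radius \<open>N\<close> that is found inside the image of some letter assigns an angle to the origin
  of \<open>y\<close>; by recognizability two such assignments differ by at most \<open>2\<^bsup>1-n\<^esup>\<close> as soon as \<open>N\<close> is large
  compared with the towers of level \<open>n\<close> (\<open>sightings_close\<close>). The limit for \<open>N \<rightarrow> \<infinity>\<close> is the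
  eigenfunction (\<open>eigenvalue_alpha\<close>).
\<close>

section \<open>A directive sequence of constant length\<close>

definition modulus :: "nat \<Rightarrow> nat" where
  "modulus n = 2 ^ (n + 2)"

text \<open>The rotation numerator \<open>p\<^sub>n = k\<^sub>n/2 - 1\<close>. It is odd, hence prime to \<open>k\<^sub>n\<close>, the quotient \<open>p\<^sub>n/k\<^sub>n\<close> stays
  in \<open>[1/4, 1/2)\<close>, and \<open>p\<^bsub>n+1\<^esub> = 2 p\<^sub>n + 1\<close>, which is the recursion that the products \<open>\<alpha> h\<^sub>n\<close> obey
  approximately.\<close>

definition rot_step :: "nat \<Rightarrow> nat" where
  "rot_step n = 2 ^ (n + 1) - 1"

definition len :: "nat \<Rightarrow> nat" where
  "len n = modulus n + 1"

definition letters :: "nat \<Rightarrow> nat set" where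
  "letters n = {0..<modulus n}"

text \<open>The letter at position \<open>i\<close> of the image of \<open>a\<close>. The letter \<open>a\<close> of level \<open>n + 1\<close> has the angle
  \<open>a/(2 k\<^sub>n)\<close>, which \<open>(a div 2)/k\<^sub>n\<close> approximates. The extra \<open>1 + a mod 2\<close> in the first letter makes the
  first step differ from all later ones and recovers the parity that \<open>a div 2\<close> forgets.\<close>

definition image_letter :: "nat \<Rightarrow> nat \<Rightarrow> nat \<Rightarrow> nat" where
  "image_letter n a i =
     (if i = 0 then a div 2 + 1 + a mod 2 else a div 2 + rot_step n * i) mod modulus n"

definition rot_subst :: "nat \<Rightarrow> nat list \<Rightarrow> nat list" where
  "rot_subst n u = concat (map (\<lambda>a. map (image_letter n a) [0..<len n]) u)"

text \<open>The image of a bi-infinite sequence, with the block of \<open>f 0\<close> starting at coordinate 0. Constant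
  length turns the cutting of coordinates into division with remainder. Finite images are handled
  through the same functions, as restrictions of images of constant sequences.\<close>

definition inflate :: "nat \<Rightarrow> (int \<Rightarrow> nat) \<Rightarrow> int \<Rightarrow> nat" where
  "inflate n f t = image_letter n (f (t div int (len n))) (nat (t mod int (len n)))"

primrec inflate_from :: "nat \<Rightarrow> nat \<Rightarrow> (int \<Rightarrow> nat) \<Rightarrow> int \<Rightarrow> nat" where
  "inflate_from n 0 f = f"
| "inflate_from n (Suc m) f = (if n \<le> m then inflate_from n m (inflate m f) else f)"

text \<open>The length of the image of a letter of level \<open>m\<close> at level \<open>n\<close>; \<open>width 0 n\<close> is the height of every
  tower of level \<open>n\<close>.\<close>

definition width :: "nat \<Rightarrow> nat \<Rightarrow> nat" where
  "width n m = (\<Prod>i\<in>{n..<m}. len i)"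

lemma modulus_Suc: "modulus (Suc n) = 2 * modulus n"
  by (simp add: modulus_def)

lemma modulus_ge_4: "4 \<le> modulus n"
  by (simp add: modulus_def)

lemma modulus_pos [simp]: "0 < modulus n"
  by (simp add: modulus_def)

lemma modulus_eq_rot_step: "modulus n = 2 * rot_step n + 2"
proof -
  have "rot_step n + 1 = 2 ^ (n + 1)"
    unfolding rot_step_def by (rule le_add_diff_inverse2) simp
  then show ?thesis by (simp add: modulus_def)
qed

lemma rot_step_Suc: "rot_step (Suc n) = 2 * rot_step n + 1"
  using modulus_eq_rot_step[of n] modulus_eq_rot_step[of "Suc n"] modulus_Suc[of n] by simp

lemma odd_rot_step: "odd (rot_step n)"
  by (simp add: rot_step_def)

lemma rot_step_ge_1: "1 \<le> rot_step n"
  using odd_rot_step[of n] by (cases "rot_step n") auto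

lemma coprime_rot_step: "coprime (rot_step n) (modulus n)"
proof -
  have "coprime (rot_step n) 2"
    using odd_rot_step[of n] by simp
  then show ?thesis
    by (simp only: modulus_def coprime_power_right_iff simp_thms)
qed

lemma len_pos [simp]: "0 < len n"
  by (simp add: len_def)

lemma len_ge_5: "5 \<le> len n"
  using modulus_ge_4[of n] by (simp add: len_def)

lemma image_letter_less [simp]: "image_letter n a i < modulus n"
  by (simp add: image_letter_def)

lemma inflate_less [simp]: "inflate n f t < modulus n"
  by (simp add: inflate_def)

lemma width_same [simp]: "width n n = 1"
  by (simp add: width_def)

lemma width_Suc: "n \<le> m \<Longrightarrow> width n (Suc m) = width n m * len m"
  by (simp add: width_def)

lemma width_pos [simp]: "0 < width n m"
  by (simp add: width_def prod_pos)

lemma width_mult: "n \<le> m \<Longrightarrow> m \<le> r \<Longrightarrow> width n r = width n m * width m r"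
  by (simp add: width_def prod.atLeastLessThan_concat)

lemma inflate_from_same [simp]: "inflate_from n n f = f"
  by (cases n) auto

lemma inflate_from_less:
  "n \<le> m \<Longrightarrow> (\<And>t. f t < modulus m) \<Longrightarrow> inflate_from n m f t < modulus n"
  by (induction m arbitrary: f) (auto simp: le_Suc_eq split: if_splits)

lemma inflate_from_less_strict: "n < m \<Longrightarrow> inflate_from n m f t < modulus n"
  by (cases m) (auto intro: inflate_from_less)

lemma inflate_from_compose:
  "n \<le> m \<Longrightarrow> m \<le> r \<Longrightarrow> inflate_from n r f = inflate_from n m (inflate_from m r f)"
  by (induction r arbitrary: f) (auto simp: le_Suc_eq)

section \<open>Iterated images as functions on the integers\<close>

text \<open>A coordinate of the iterated image sees one letter of the preimage, at the quotient, and its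
  place in the block, the remainder.\<close>

lemma inflate_from_cong:
  assumes "n \<le> m" "t mod int (width n m) = t' mod int (width n m)"
    "f (t div int (width n m)) = f' (t' div int (width n m))"
  shows "inflate_from n m f t = inflate_from n m f' t'"
  using assms
proof (induction m arbitrary: f f')
  case 0
  then show ?case by simp
next
  case (Suc m)
  show ?case
  proof (cases "n \<le> m")
    case True
    let ?w = "int (width n m)" and ?l = "int (len m)"
    have w: "int (width n (Suc m)) = ?w * ?l"
      using True by (simp add: width_Suc)
    have md: "?w * (t div ?w mod ?l) + t mod ?w = ?w * (t' div ?w mod ?l) + t' mod ?w"
      using Suc.prems(2) by (simp add: w zmod_zmult2_eq)
    have m1: "t mod ?w = t' mod ?w"
      using arg_cong[OF md, of "\<lambda>z. z mod ?w"] by simp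
    have m2: "t div ?w mod ?l = t' div ?w mod ?l"
      using md m1 width_pos[of n m] by (simp del: width_pos)
    have "f (t div ?w div ?l) = f' (t' div ?w div ?l)"
      using Suc.prems(3) by (simp add: w zdiv_zmult2_eq)
    then have "inflate m f (t div ?w) = inflate m f' (t' div ?w)"
      using m2 by (simp add: inflate_def)
    then show ?thesis
      using Suc.IH[OF True m1] True by simp
  next
    case False
    then show ?thesis using Suc.prems by (simp add: width_def)
  qed
qed

lemma length_rot_subst [simp]: "length (rot_subst n u) = length u * len n"
  by (induction u) (auto simp: rot_subst_def)

lemma nth_rot_subst:
  "t < length u * len n \<Longrightarrow> rot_subst n u ! t = inflate n (\<lambda>j. u ! nat j) (int t)"
proof (induction u arbitrary: t)
  case Nil
  then show ?case by simp
next
  case (Cons a u)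
  have eq: "rot_subst n (a # u) = map (image_letter n a) [0..<len n] @ rot_subst n u"
    by (simp add: rot_subst_def)
  show ?case
  proof (cases "t < len n")
    case True
    then show ?thesis
      by (simp add: eq nth_append inflate_def flip: zdiv_int zmod_int)
  next
    case False
    then obtain s where s: "t = len n + s"
      using le_Suc_ex[of "len n" t] by auto
    then have "s < length u * len n"
      using Cons.prems by simp
    then have "rot_subst n (a # u) ! t = inflate n (\<lambda>j. u ! nat j) (int s)"
      using Cons.IH by (simp add: eq s nth_append)
    also have "\<dots> = inflate n (\<lambda>j. (a # u) ! nat j) (int t)"
      by (simp add: inflate_def s nat_add_distrib flip: zdiv_int zmod_int)
    finally show ?thesis .
  qed
qed

lemma tau_comp_Suc:
  assumes "n \<le> m"
  shows "tau_comp \<tau> n (Suc m) u = tau_comp \<tau> n m (\<tau> m u)"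
proof -
  have "foldr (\<circ>) xs f v = foldr (\<circ>) xs id (f v)" for xs and f :: "'a list \<Rightarrow> 'a list" and v
    by (induction xs) auto
  from this[of "map \<tau> [n..<m]" "\<tau> m" u] show ?thesis
    using assms by (simp add: tau_comp_def)
qed

lemma tau_comp_same [simp]: "tau_comp \<tau> n n u = u"
  by (simp add: tau_comp_def)

lemma length_tau_comp:
  "n \<le> m \<Longrightarrow> length (tau_comp rot_subst n m u) = length u * width n m"
proof (induction m arbitrary: u)
  case 0
  then show ?case by simp
next
  case (Suc m)
  then show ?case
    by (cases "n \<le> m") (auto simp: tau_comp_Suc width_Suc le_Suc_eq)
qed

lemma nth_tau_comp:
  "n \<le> m \<Longrightarrow> t < length u * width n m \<Longrightarrow>
     tau_comp rot_subst n m u ! t = inflate_from n m (\<lambda>j. u ! nat j) (int t)"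
proof (induction m arbitrary: u)
  case 0
  then show ?case by simp
next
  case (Suc m)
  show ?case
  proof (cases "n \<le> m")
    case True
    then have t: "t < length u * len m * width n m"
      using Suc.prems by (simp add: width_Suc algebra_simps)
    then have "t div width n m < length u * len m"
      by (simp add: less_mult_imp_div_less)
    then have "rot_subst m u ! (t div width n m) = inflate m (\<lambda>j. u ! nat j) (int (t div width n m))"
      by (rule nth_rot_subst)
    then have "inflate_from n m (\<lambda>j. rot_subst m u ! nat j) (int t) =
        inflate_from n m (inflate m (\<lambda>j. u ! nat j)) (int t)"
      using True by (intro inflate_from_cong) (simp_all flip: zdiv_int)
    then show ?thesis
      using True Suc.IH[OF True, of "rot_subst m u"] t by (simp add: tau_comp_Suc)
  next
    case False
    then show ?thesis using Suc.prems by (simp add: le_Suc_eq)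
  qed
qed

lemma nth_tau_comp_letter:
  assumes "n \<le> m" "t < width n m"
  shows "tau_comp rot_subst n m [a] ! t = inflate_from n m (\<lambda>_. a) (int t)"
proof -
  have "inflate_from n m (\<lambda>j. [a] ! nat j) (int t) = inflate_from n m (\<lambda>_. a) (int t)"
    using assms by (intro inflate_from_cong) (simp_all flip: zdiv_int)
  then show ?thesis
    using assms by (simp add: nth_tau_comp)
qed

lemma height_rot_subst: "height rot_subst n u = length u * width 0 n"
  by (simp add: height_def length_tau_comp)

lemma length_factor_at [simp]: "length (factor_at x i w) = w"
  by (simp add: factor_at_def)

lemma nth_factor_at [simp]: "j < w \<Longrightarrow> factor_at x i w ! j = x (i + int j)"
  by (simp add: factor_at_def)

text \<open>This moves membership in a level shift from words to equations between functions on the integers.\<close>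

lemma sublist_tau_comp_iff:
  assumes "n \<le> m"
  shows "sublist (factor_at x i w) (tau_comp rot_subst n m [a]) \<longleftrightarrow>
    (\<exists>s. s + w \<le> width n m \<and>
       (\<forall>j<w. x (i + int j) = inflate_from n m (\<lambda>_. a) (int (s + j))))"
proof
  assume "sublist (factor_at x i w) (tau_comp rot_subst n m [a])"
  then obtain ps ss where eq: "tau_comp rot_subst n m [a] = ps @ factor_at x i w @ ss"
    by (auto simp: sublist_def)
  have le: "length ps + w \<le> width n m"
    using arg_cong[OF eq, of length] assms by (simp add: length_tau_comp)
  have "x (i + int j) = inflate_from n m (\<lambda>_. a) (int (length ps + j))" if "j < w" for j
  proof -
    have "x (i + int j) = tau_comp rot_subst n m [a] ! (length ps + j)"
      using that by (simp add: eq nth_append)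
    then show ?thesis
      using that le assms by (simp add: nth_tau_comp_letter)
  qed
  then show "\<exists>s. s + w \<le> width n m \<and>
       (\<forall>j<w. x (i + int j) = inflate_from n m (\<lambda>_. a) (int (s + j)))"
    using le by blast
next
  assume "\<exists>s. s + w \<le> width n m \<and>
       (\<forall>j<w. x (i + int j) = inflate_from n m (\<lambda>_. a) (int (s + j)))"
  then obtain s where s: "s + w \<le> width n m"
    "\<And>j. j < w \<Longrightarrow> x (i + int j) = inflate_from n m (\<lambda>_. a) (int (s + j))"
    by blast
  let ?u = "tau_comp rot_subst n m [a]"
  have "factor_at x i w = take w (drop s ?u)"
    using s assms by (intro nth_equalityI) (auto simp: length_tau_comp nth_tau_comp_letter)
  then show "sublist (factor_at x i w) ?u"
    by (metis sublist_drop sublist_take sublist_order.order_trans)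
qed

lemma cut_pos_const:
  assumes "\<And>i. length (\<sigma> [x i]) = w"
  shows "cut_pos \<sigma> x k = k * int w"
  using assms by (simp add: cut_pos_def)

text \<open>All blocks have the same length, so the block covering coordinate \<open>j\<close> has index \<open>j div width 0 n\<close>.\<close>

lemma subst_biinf_tau_comp:
  "subst_biinf (tau_comp rot_subst 0 n) x = inflate_from 0 n x"
proof
  fix j
  let ?w = "int (width 0 n)"
  have cut: "cut_pos (tau_comp rot_subst 0 n) x k = k * ?w" for k
    by (rule cut_pos_const) (simp add: length_tau_comp)
  have wpos: "0 < ?w" by simp
  have the: "(THE k. k * ?w \<le> j \<and> j < (k + 1) * ?w) = j div ?w"
  proof (rule the_equality)
    show "j div ?w * ?w \<le> j \<and> j < (j div ?w + 1) * ?w"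
      using div_mult_mod_eq[of j ?w] pos_mod_sign[OF wpos, of j] pos_mod_bound[OF wpos, of j]
      unfolding distrib_right by linarith
  next
    fix k assume "k * ?w \<le> j \<and> j < (k + 1) * ?w"
    then show "k = j div ?w"
      by (intro int_div_pos_eq[symmetric, where r = "j - k * ?w"]) (auto simp: algebra_simps)
  qed
  have r: "j - j div ?w * ?w = j mod ?w"
    by (simp add: minus_div_mult_eq_mod)
  have lt: "nat (j mod ?w) < width 0 n"
    using pos_mod_bound[OF wpos, of j] pos_mod_sign[OF wpos, of j] by linarith
  have "subst_biinf (tau_comp rot_subst 0 n) x j = tau_comp rot_subst 0 n [x (j div ?w)] ! nat (j mod ?w)"
    by (simp add: subst_biinf_def cut the r Let_def)
  also have "\<dots> = inflate_from 0 n (\<lambda>_. x (j div ?w)) (j mod ?w)"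
    using lt pos_mod_sign[OF wpos, of j] by (simp add: nth_tau_comp_letter)
  also have "\<dots> = inflate_from 0 n x j"
    by (intro inflate_from_cong) auto
  finally show "subst_biinf (tau_comp rot_subst 0 n) x j = inflate_from 0 n x j" .
qed

section \<open>Primitivity\<close>

lemma image_letter_0:
  "image_letter n a 0 = (a div 2 + 1 + a mod 2) mod modulus n"
  by (simp add: image_letter_def)

lemma image_letter_pos:
  "0 < i \<Longrightarrow> image_letter n a i = (a div 2 + rot_step n * i) mod modulus n"
  by (simp add: image_letter_def)

lemma image_letter_plain_step:
  assumes "0 < i"
  shows "image_letter n a (Suc i) = (image_letter n a i + rot_step n) mod modulus n"
  using assms by (simp add: image_letter_pos mod_simps algebra_simps)

text \<open>The first step falls short of the rotation by \<open>1 + a mod 2\<close>, which is 1 or 2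
  and thus nonzero for a modulus of at least 4. This is what marks the beginning of an image.\<close>

lemma image_letter_first_step:
  "image_letter n a 1 \<noteq> (image_letter n a 0 + rot_step n) mod modulus n"
proof
  let ?k = "modulus n"
  assume "image_letter n a 1 = (image_letter n a 0 + rot_step n) mod ?k"
  then have "[a div 2 + rot_step n + 0 = a div 2 + rot_step n + (1 + a mod 2)] (mod ?k)"
    by (simp add: image_letter_0 image_letter_pos cong_def mod_simps algebra_simps)
  then have "[0 = 1 + a mod 2] (mod ?k)"
    by (simp only: cong_add_lcancel_nat)
  moreover have "1 + a mod 2 < ?k"
    using modulus_ge_4[of n] by linarith
  ultimately show False
    by (simp add: cong_def)
qed

text \<open>The second letter determines \<open>a div 2\<close>; the first one then yields the parity of \<open>a\<close>.\<close>

lemma image_letter_inj: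
  assumes "a < modulus (Suc n)" "b < modulus (Suc n)"
    "image_letter n a 0 = image_letter n b 0" "image_letter n a 1 = image_letter n b 1"
  shows "a = b"
proof -
  let ?k = "modulus n"
  have "[rot_step n + a div 2 = rot_step n + b div 2] (mod ?k)"
    using assms(4) by (simp add: image_letter_pos cong_def algebra_simps)
  then have "[a div 2 = b div 2] (mod ?k)"
    by (simp only: cong_add_lcancel_nat)
  then have half: "a div 2 = b div 2"
    using assms(1,2) by (auto simp: cong_def modulus_Suc mod_less less_mult_imp_div_less)
  have "[a div 2 + 1 + a mod 2 = a div 2 + 1 + b mod 2] (mod ?k)"
    using assms(3) half by (simp add: image_letter_0 cong_def)
  then have "[a mod 2 = b mod 2] (mod ?k)"
    by (simp only: cong_add_lcancel_nat)
  moreover have "a mod 2 < ?k" "b mod 2 < ?k"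
    using modulus_ge_4[of n] by linarith+
  ultimately have "a mod 2 = b mod 2"
    by (simp add: cong_def)
  with half show ?thesis
    by (metis div_mult_mod_eq)
qed

text \<open>The positions \<open>1, \<dots>, k\<^sub>n\<close> run through a full orbit of the rotation by \<open>p\<^sub>n\<close>, which is transitive
  because \<open>p\<^sub>n\<close> is prime to \<open>k\<^sub>n\<close>.\<close>

lemma ex_image_letter:
  assumes "b < modulus n"
  shows "\<exists>i<len n. image_letter n a i = b"
proof -
  let ?k = "modulus n"
  obtain y where y: "[rot_step n * y = 1] (mod ?k)"
    using cong_solve_coprime_nat[OF coprime_rot_step[of n]] by auto
  obtain z where z: "[a div 2 + z = b] (mod ?k)"
  proof
    have "a div 2 + (b + (?k - 1) * (a div 2)) = b + ?k * (a div 2)"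
      using modulus_pos[of n] by (cases ?k) simp_all
    then show "[a div 2 + (b + (?k - 1) * (a div 2)) = b] (mod ?k)"
      by (simp only: cong_def mod_mult_self2)
  qed
  \<comment> \<open>the representative in \<open>{1..k\<^sub>n}\<close>, as position 0 does not follow the rotation\<close>
  define i where "i = (if z * y mod ?k = 0 then ?k else z * y mod ?k)"
  have i: "0 < i" "i < len n" "[i = z * y] (mod ?k)"
    by (auto simp: i_def len_def cong_def less_Suc_eq)
  have "[rot_step n * i = rot_step n * (z * y)] (mod ?k)"
    using i(3) by (rule cong_scalar_left)
  also have "rot_step n * (z * y) = z * (rot_step n * y)"
    by simp
  also have "[z * (rot_step n * y) = z * 1] (mod ?k)"
    using y by (rule cong_scalar_left)
  finally have "[a div 2 + rot_step n * i = a div 2 + z] (mod ?k)"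
    by (simp add: cong_add_lcancel_nat)
  also note z
  finally have "image_letter n a i = b"
    using assms i(1) by (simp add: image_letter_pos cong_def)
  then show ?thesis
    using i(2) by blast
qed

lemma rot_subst_append: "rot_subst n (u @ v) = rot_subst n u @ rot_subst n v"
  by (simp add: rot_subst_def)

lemma set_rot_subst_letter: "set (rot_subst n [a]) = letters n"
  using ex_image_letter[of _ n a] by (fastforce simp: rot_subst_def letters_def)

lemma set_rot_subst_subset: "set (rot_subst n u) \<subseteq> letters n"
  by (auto simp: rot_subst_def letters_def)

lemma directive_sequence_rot_subst: "directive_sequence letters rot_subst"
  unfolding directive_sequence_def
proof (intro conjI allI)
  fix n
  show "alphabet (letters n)"
    using modulus_ge_4[of n] by (simp add: alphabet_def letters_def)
  have "rot_subst n [a] \<noteq> []" for a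
    using length_rot_subst[of n "[a]"] by (metis len_pos length_0_conv length_Cons mult_1 
        list.size(3) nat_less_le One_nat_def)
  moreover have "letters (Suc n) \<noteq> {}"
    by (auto simp: letters_def)
  ultimately show "substitution (letters (Suc n)) (letters n) (rot_subst n)"
    using set_rot_subst_subset[of n] 
    by (auto simp: substitution_def rot_subst_append set_rot_subst_letter lists_eq_set) (simp add: rot_subst_def)
qed

lemma primitive_seq_rot_subst: "primitive_seq letters rot_subst"
  unfolding primitive_seq_def
proof
  fix n
  have "b \<in> set (tau_comp rot_subst n (Suc n) [a])" if "b \<in> letters n" for a b
    using that by (simp add: tau_comp_Suc set_rot_subst_letter)
  then show "\<exists>m>n. \<forall>b\<in>letters n. \<forall>a\<in>letters m. b \<in> set (tau_comp rot_subst n m [a])"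
    by blast
qed

section \<open>Recognizability\<close>

lemma inflate_step:
  assumes "t mod int (len n) = int i"  "Suc i < len n"
  shows "inflate n f t = image_letter n (f (t div int (len n))) i"
    and "inflate n f (t + 1) = image_letter n (f (t div int (len n))) (Suc i)"
proof -
  have t: "t = int (len n) * (t div int (len n)) + int i"
    using mult_div_mod_eq[of "int (len n)" t] assms(1) by simp
  have "(t + 1) div int (len n) = t div int (len n)"
    using t assms(2) by (intro int_div_pos_eq[where r = "int i + 1"]) auto
  moreover have "(t + 1) mod int (len n) = int i + 1"
    using t assms(2) by (intro int_mod_pos_eq[where q = "t div int (len n)"]) auto
  ultimately show "inflate n f (t + 1) = image_letter n (f (t div int (len n))) (Suc i)"
    by (simp add: inflate_def nat_add_distrib)
  show "inflate n f t = image_letter n (f (t div int (len n))) i"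
    using assms(1) by (simp add: inflate_def)
qed

text \<open>A step different from the rotation is either the first step of a block or the passage from one
  block to the next. Nothing is known about that passage, since \<open>f\<close> is an arbitrary sequence.\<close>

lemma nonplain_step_position:
  assumes "inflate n f (t + 1) \<noteq> (inflate n f t + rot_step n) mod modulus n"
  shows "t mod int (len n) = 0 \<or> (t + 1) mod int (len n) = 0"
proof (rule ccontr)
  assume neg: "\<not> ?thesis"
  let ?l = "int (len n)"
  obtain i where i: "t mod ?l = int i"
    using zero_le_imp_eq_int[of "t mod ?l"] by auto
  then have "0 < i" "i < len n"
    using neg pos_mod_bound[of ?l t] by auto
  moreover have "Suc i \<noteq> len n"
  proof
    assume "Suc i = len n"
    then have "(t mod ?l + 1) mod ?l = 0"
      using i by (metis int_Suc mod_self of_nat_Suc add.commute)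
    then show False
      using neg by (simp add: mod_simps)
  qed
  ultimately have "Suc i < len n" by simp
  from inflate_step[OF i this, of f] assms show False
    using image_letter_plain_step[OF \<open>0 < i\<close>] by simp
qed

lemma block_start_nonplain:
  assumes "t mod int (len n) = 0"
  shows "inflate n f (t + 1) \<noteq> (inflate n f t + rot_step n) mod modulus n"
proof -
  have "t mod int (len n) = int 0" "Suc 0 < len n"
    using assms len_ge_5[of n] by auto
  from inflate_step[OF this, of f] show ?thesis
    using image_letter_first_step[of n] by simp
qed

text \<open>Align two images that agree on a window. The start of a block of the first one is a step that is
  not the rotation, so in the second image it is at a start or just before one, and the same
  holds with the two images exchanged. Two cuttings that differ could therefore only differ by \<open>1\<close>
  and by \<open>-1\<close> modulo the block length at the same time, which is impossible for blocks longer than 2.\<close>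

lemma inflate_recognizable:
  fixes q q' :: int
  assumes f: "\<And>t. f t < modulus (Suc n)" "\<And>t. f' t < modulus (Suc n)"
    and eq: "\<And>u. \<bar>u\<bar> \<le> int (len n) \<Longrightarrow> inflate n f (q + u) = inflate n f' (q' + u)"
  shows "q mod int (len n) = q' mod int (len n) \<and>
    f (q div int (len n)) = f' (q' div int (len n))"
proof -
  let ?l = "int (len n)"
  define i where "i = q mod ?l"
  define i' where "i' = q' mod ?l"
  have bounds: "0 \<le> i" "i < ?l" "0 \<le> i'" "i' < ?l" "5 \<le> ?l"
    using len_ge_5[of n] by (auto simp: i_def i'_def)
  have start: "(q - i) mod ?l = 0" "(q' - i') mod ?l = 0"
    by (simp_all add: i_def i'_def)
  have "inflate n f' (q' - i + 1) \<noteq> (inflate n f' (q' - i) + rot_step n) mod modulus n"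
    using block_start_nonplain[OF start(1), of f] eq[of "- i"] eq[of "- i + 1"] bounds by (simp add: algebra_simps)
  then have "(q' - i) mod ?l = 0 \<or> (q' - i + 1) mod ?l = 0"
    by (rule nonplain_step_position)
  then have d: "?l dvd i' - i \<or> ?l dvd i' - i + 1"
    using mod_diff_left_eq[of q' ?l i] mod_diff_left_eq[of q' ?l "i - 1"]
    by (simp add: i'_def mod_eq_0_iff_dvd[symmetric] algebra_simps)
  have "inflate n f (q - i' + 1) \<noteq> (inflate n f (q - i') + rot_step n) mod modulus n"
    using block_start_nonplain[OF start(2), of f'] eq[of "- i'"] eq[of "- i' + 1"] bounds by (simp add: algebra_simps)
  then have "(q - i') mod ?l = 0 \<or> (q - i' + 1) mod ?l = 0"
    by (rule nonplain_step_position)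
  then have d': "?l dvd i - i' \<or> ?l dvd i - i' + 1"
    using mod_diff_left_eq[of q ?l i'] mod_diff_left_eq[of q ?l "i' - 1"]
    by (simp add: i_def mod_eq_0_iff_dvd[symmetric] algebra_simps)
  have "?l dvd i' - i"
  proof (rule ccontr)
    assume neg: "\<not> ?thesis"
    then have "\<not> ?l dvd i - i'"
      by (metis dvd_minus_iff minus_diff_eq)
    \<comment> \<open>both differences are then \<open>-1\<close> modulo the length, and their sum is 0\<close>
    with neg d d' have "?l dvd (i' - i + 1) + (i - i' + 1)"
      by (metis dvd_add)
    then have "?l \<le> 2"
      by (intro zdvd_imp_le) auto
    then show False
      using bounds by simp
  qed
  then have ii: "i = i'"
    using bounds by (metis dvd_imp_mod_0 i'_def i_def mod_eq_dvd_iff mod_mod_trivial)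
  have "q - i = ?l * (q div ?l)" "q' - i = ?l * (q' div ?l)"
    unfolding minus_mod_eq_mult_div[symmetric] by (simp add: i_def) (simp add: ii i'_def)
  then have div: "(q - i) div ?l = q div ?l" "(q' - i) div ?l = q' div ?l"
    using bounds by simp_all
  have md: "(q - i) mod ?l = int 0" "(q' - i) mod ?l = int 0" "Suc 0 < len n"
    using start ii len_ge_5[of n] by auto
  have "f (q div ?l) = f' (q' div ?l)"
  proof (rule image_letter_inj[OF f])
    show "image_letter n (f (q div ?l)) 0 = image_letter n (f' (q' div ?l)) 0"
      using inflate_step(1)[OF md(1,3), of f] inflate_step(1)[OF md(2,3), of f'] eq[of "- i"] bounds
      by (simp add: div)
    show "image_letter n (f (q div ?l)) 1 = image_letter n (f' (q' div ?l)) 1"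
      using inflate_step(2)[OF md(1,3), of f] inflate_step(2)[OF md(2,3), of f'] eq[of "- i + 1"] bounds
      by (simp add: div algebra_simps)
  qed
  with ii show ?thesis
    by (simp add: i_def i'_def)
qed

text \<open>The window has to be finite: the statement is applied to bi-infinite points, where it gives
  recognizability of the sequence, and to windows inside images of single letters, where
  it gives continuity of the eigenfunction. The induction on the level applies the hypothesis to
  all coordinates \<open>s + v h\<^sub>n\<close> with \<open>|v|\<close> at most the next block length and then desubstitutes once more.\<close>

lemma local_recognizability:
  "\<exists>N::nat. \<forall>f f' s s'. (\<forall>t. f t < modulus n) \<longrightarrow> (\<forall>t. f' t < modulus n) \<longrightarrow>
     (\<forall>u. \<bar>u\<bar> \<le> int N \<longrightarrow> inflate_from 0 n f (s + u) = inflate_from 0 n f' (s' + u)) \<longrightarrow>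
     s mod int (width 0 n) = s' mod int (width 0 n) \<and>
     f (s div int (width 0 n)) = f' (s' div int (width 0 n))"
proof (induction n)
  case 0
  have "s mod int (width 0 0) = s' mod int (width 0 0) \<and>
     f (s div int (width 0 0)) = f' (s' div int (width 0 0))"
    if "\<forall>u. \<bar>u\<bar> \<le> int 0 \<longrightarrow> inflate_from 0 0 f (s + u) = inflate_from 0 0 f' (s' + u)"
    for s s' :: int and f f' :: "int \<Rightarrow> nat"
    using that[rule_format, of 0] by simp
  then show ?case by blast
next
  case (Suc n)
  let ?w = "int (width 0 n)" and ?l = "int (len n)"
  obtain N where N: "s mod ?w = s' mod ?w \<and> f (s div ?w) = f' (s' div ?w)"
    if "\<And>t. f t < modulus n" "\<And>t. f' t < modulus n"
      "\<And>u. \<bar>u\<bar> \<le> int N \<Longrightarrow> inflate_from 0 n f (s + u) = inflate_from 0 n f' (s' + u)"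
    for f f' s s'
    using Suc.IH by blast
  have W: "int (width 0 (Suc n)) = ?w * ?l"
    by (simp add: width_Suc)
  have "s mod (?w * ?l) = s' mod (?w * ?l) \<and> f (s div (?w * ?l)) = f' (s' div (?w * ?l))"
    if f: "\<And>t. f t < modulus (Suc n)" "\<And>t. f' t < modulus (Suc n)"
      and eq: "\<And>u. \<bar>u\<bar> \<le> int (N + len n * width 0 n) \<Longrightarrow>
        inflate_from 0 (Suc n) f (s + u) = inflate_from 0 (Suc n) f' (s' + u)"
    for f f' s s'
  proof -
    have blocks: "s mod ?w = s' mod ?w \<and>
        inflate n f (s div ?w + v) = inflate n f' (s' div ?w + v)" if v: "\<bar>v\<bar> \<le> ?l" for v
    proof -
      have "(s + v * ?w) mod ?w = (s' + v * ?w) mod ?w \<and>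
        inflate n f ((s + v * ?w) div ?w) = inflate n f' ((s' + v * ?w) div ?w)"
      proof (rule N)
        fix u :: int assume u: "\<bar>u\<bar> \<le> int N"
        have "\<bar>v * ?w\<bar> \<le> ?l * ?w"
          using v by (simp add: abs_mult mult_right_mono)
        then have "\<bar>v * ?w + u\<bar> \<le> int (N + len n * width 0 n)"
          using u by simp
        from eq[OF this] show "inflate_from 0 n (inflate n f) (s + v * ?w + u) =
            inflate_from 0 n (inflate n f') (s' + v * ?w + u)"
          by (simp add: add.assoc)
      qed simp_all
      then show ?thesis by (simp add: add.commute)
    qed
    then have "s div ?w mod ?l = s' div ?w mod ?l \<and> f (s div ?w div ?l) = f' (s' div ?w div ?l)"
      by (intro inflate_recognizable[OF f]) auto
    then show ?thesis
      using blocks[of 0] by (simp add: zdiv_zmult2_eq zmod_zmult2_eq)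
  qed
  then show ?case
    unfolding W by (intro exI[of _ "N + len n * width 0 n"]) blast
qed

lemma funpow_shift: "(shift ^^ k) x = (\<lambda>t. x (t + int k))"
  by (induction k arbitrary: x) (auto simp: shift_def algebra_simps)

lemma recognizable_seq_rot_subst: "recognizable_seq letters rot_subst"
  unfolding recognizable_seq_def
proof (intro allI impI)
  fix n :: nat
  let ?w = "int (width 0 n)"
  obtain N where N: "s mod ?w = s' mod ?w \<and> f (s div ?w) = f' (s' div ?w)"
    if "\<And>t. f t < modulus n" "\<And>t. f' t < modulus n"
      "\<And>u. \<bar>u\<bar> \<le> int N \<Longrightarrow> inflate_from 0 n f (s + u) = inflate_from 0 n f' (s' + u)"
    for f f' s s'
    using local_recognizability[of n] by blast
  have "a = a' \<and> k = k'"
    if y: "y \<in> (shift ^^ k) ` base letters rot_subst n a" "y \<in> (shift ^^ k') ` base letters rot_subst n a'"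
      and k: "k < width 0 n" "k' < width 0 n" for a a' k k' y
  proof -
    obtain x x' where x: "x \<in> level_shift letters rot_subst n" "x 0 = a" "x' \<in> level_shift letters rot_subst n" "x' 0 = a'"
      and eq: "y = (shift ^^ k) (inflate_from 0 n x)" "y = (shift ^^ k') (inflate_from 0 n x')"
      using y unfolding base_def subst_biinf_tau_comp by blast
    have "inflate_from 0 n x (int k + u) = inflate_from 0 n x' (int k' + u)" for u
      using fun_cong[OF eq(1), of u] fun_cong[OF eq(2), of u] by (simp add: funpow_shift add.commute)
    then have "int k mod ?w = int k' mod ?w \<and> x (int k div ?w) = x' (int k' div ?w)"
      using x(1,3) by (intro N) (auto simp: level_shift_def letters_def)
    then show ?thesis
      using k x by simp
  qed
  then show "disjoint_family_on (\<lambda>(a, k). (shift ^^ k) ` base letters rot_subst n a)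
               {(a, k). a \<in> letters n \<and> k < height rot_subst n [a]}"
    unfolding disjoint_family_on_def by (fastforce simp: height_rot_subst)
qed

section \<open>Points of the level shifts\<close>

text \<open>The images of the letter 1 are nested, as 1 stands at position \<open>p\<^sub>m\<close> of its own image at level \<open>m\<close>;
  \<open>centre n m\<close> is the place where the chosen copy of 1 of level \<open>n\<close> sits in the image of the letter 1
  of level \<open>m\<close>. That position is interior, so the images grow to both sides and exhaust a
  bi-infinite sequence.\<close>

definition centre :: "nat \<Rightarrow> nat \<Rightarrow> nat" where
  "centre n m = (\<Sum>j\<in>{n..<m}. rot_step j * width n j)"

text \<open>The union of the nested images of 1. Level \<open>n + |t|\<close> is deep enough to cover the coordinate \<open>t\<close>.\<close>

definition seed_point :: "nat \<Rightarrow> int \<Rightarrow> nat" where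
  "seed_point n t = (let m = n + nat \<bar>t\<bar> in inflate_from n m (\<lambda>_. 1) (t + int (centre n m)))"

text \<open>\<open>p\<^sub>n\<close> is its own inverse modulo \<open>k\<^sub>n\<close>: from \<open>k\<^sub>n = 2 p\<^sub>n + 2\<close> one gets \<open>p\<^sub>n\<^sup>2 = (k\<^sub>n/2)\<^sup>2 - k\<^sub>n + 1\<close>, and
  \<open>(k\<^sub>n/2)\<^sup>2\<close> is a multiple of \<open>k\<^sub>n\<close>.\<close>

lemma image_letter_rot_step: "image_letter n 1 (rot_step n) = 1"
proof -
  have "rot_step n * rot_step n = modulus n * (2 ^ n - 1) + 1"
  proof -
    define x :: nat where "x = 2 ^ n - 1"
    have x: "2 ^ n = x + 1" by (simp add: x_def)
    then have "rot_step n = 2 * x + 1" "modulus n = 4 * x + 4"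
      by (simp_all add: rot_step_def modulus_def)
    then show ?thesis
      by (simp add: x algebra_simps)
  qed
  then show ?thesis
    using rot_step_ge_1[of n] modulus_ge_4[of n]
    by (simp only: image_letter_pos) (simp add: mod_Suc)
qed

lemma rot_step_less_len: "rot_step n + 1 < len n"
  using modulus_eq_rot_step[of n] by (simp add: len_def)

lemma centre_Suc: "n \<le> m \<Longrightarrow> centre n (Suc m) = rot_step m * width n m + centre n m"
  by (simp add: centre_def)

text \<open>At least one letter is gained on each side when the level increases.\<close>

lemma centre_bounds: "n \<le> m \<Longrightarrow> m - n \<le> centre n m \<and> centre n m + (m - n) < width n m"
proof (induction m rule: dec_induct)
  case base
  then show ?case by (simp add: centre_def)
next
  case (step m)
  let ?w = "width n m" and ?p = "rot_step m"
  have w: "1 \<le> ?w" by (simp add: Suc_le_eq)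
  have "1 * 1 \<le> ?p * ?w"
    using w rot_step_ge_1[of m] by (intro mult_le_mono)
  moreover have "(?p + 2) * ?w \<le> len m * ?w"
    using rot_step_less_len[of m] by (intro mult_le_mono) auto
  then have "?p * ?w + ?w + ?w \<le> len m * ?w"
    by (simp add: algebra_simps)
  moreover have "Suc m - n = Suc (m - n)" "centre n (Suc m) = ?p * ?w + centre n m"
      "width n (Suc m) = len m * ?w"
    using step by (simp_all add: centre_Suc width_Suc Suc_diff_le)
  ultimately show ?case
    using step.IH w by linarith
qed

lemma inflate_from_centre_Suc:
  assumes "n \<le> m" "0 \<le> t + int (centre n m)" "t + int (centre n m) < int (width n m)"
  shows "inflate_from n (Suc m) (\<lambda>_. 1) (t + int (centre n (Suc m))) =
    inflate_from n m (\<lambda>_. 1) (t + int (centre n m))"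
proof -
  let ?w = "int (width n m)" and ?s = "t + int (centre n m)"
  have s: "t + int (centre n (Suc m)) = ?s + int (rot_step m) * ?w"
    using assms(1) by (simp add: centre_Suc)
  have "inflate_from n m (inflate m (\<lambda>_. 1)) (?s + int (rot_step m) * ?w) =
      inflate_from n m (\<lambda>_. 1) ?s"
  proof (rule inflate_from_cong[OF assms(1)])
    have "int (rot_step m) mod int (len m) = int (rot_step m)"
      using rot_step_less_len[of m] by simp
    moreover have "(?s + int (rot_step m) * ?w) div ?w = int (rot_step m)"
      using assms by simp
    ultimately show "inflate m (\<lambda>_. 1) ((?s + int (rot_step m) * ?w) div ?w) = 1"
      by (simp only: inflate_def nat_int image_letter_rot_step)
  qed simp
  then show ?thesis
    using assms(1) by (simp add: s)
qed

text \<open>Recentred images of 1 from deeper levels extend those from shallower ones.\<close>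

lemma inflate_from_centre_extend:
  assumes "n \<le> m" "0 \<le> t + int (centre n m)" "t + int (centre n m) < int (width n m)"
  shows "inflate_from n (m + d) (\<lambda>_. 1) (t + int (centre n (m + d))) =
      inflate_from n m (\<lambda>_. 1) (t + int (centre n m))
    \<and> 0 \<le> t + int (centre n (m + d)) \<and> t + int (centre n (m + d)) < int (width n (m + d))"
proof (induction d)
  case 0
  then show ?case using assms by simp
next
  case (Suc d)
  let ?m = "m + d"
  have n: "n \<le> ?m" using assms(1) by simp
  have "(rot_step ?m + 1) * width n ?m \<le> len ?m * width n ?m"
    using rot_step_less_len[of ?m] by (intro mult_le_mono) auto
  then have "rot_step ?m * width n ?m + width n ?m \<le> width n (Suc ?m)"
    using n by (simp add: width_Suc algebra_simps)
  then have le: "int (rot_step ?m * width n ?m) + int (width n ?m) \<le> int (width n (Suc ?m))"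
    by linarith
  have "int (centre n (Suc ?m)) = int (rot_step ?m * width n ?m) + int (centre n ?m)"
    using n by (simp add: centre_Suc)
  moreover have "0 \<le> int (rot_step ?m * width n ?m)"
    by (rule of_nat_0_le_iff)
  ultimately show ?case
    using Suc.IH inflate_from_centre_Suc[OF n, of t] le unfolding add_Suc_right by linarith
qed

lemma seed_point_eq:
  assumes "n \<le> m" "0 \<le> t + int (centre n m)" "t + int (centre n m) < int (width n m)"
  shows "seed_point n t = inflate_from n m (\<lambda>_. 1) (t + int (centre n m))"
proof -
  let ?m0 = "n + nat \<bar>t\<bar>"
  have v: "0 \<le> t + int (centre n ?m0)" "t + int (centre n ?m0) < int (width n ?m0)"
    using centre_bounds[of n ?m0] by simp_all linarith+
  show ?thesis
  proof (cases "m \<le> ?m0")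
    case True
    then obtain d where "?m0 = m + d" using le_Suc_ex by blast
    then show ?thesis
      using inflate_from_centre_extend[OF assms, of d] by (simp add: seed_point_def Let_def)
  next
    case False
    then obtain d where "m = ?m0 + d" using le_Suc_ex[of ?m0 m] by auto
    then show ?thesis
      using inflate_from_centre_extend[OF _ v, of d] by (simp add: seed_point_def Let_def)
  qed
qed

lemma seed_point_in_level_shift: "seed_point n \<in> level_shift letters rot_subst n"
proof -
  have "seed_point n k \<in> letters n" for k
    using inflate_from_less[of n "n + nat \<bar>k\<bar>" "\<lambda>_. 1"] modulus_ge_4[of "n + nat \<bar>k\<bar>"]
    by (simp add: seed_point_def Let_def letters_def)
  moreover have "\<exists>m>n. \<exists>a\<in>letters m. sublist (factor_at (seed_point n) i w) (tau_comp rot_subst n m [a])"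
    for i w
  proof -
    define m where "m = n + 1 + nat \<bar>i\<bar> + w"
    have m: "n < m" "n \<le> m" by (auto simp: m_def)
    define s where "s = nat (i + int (centre n m))"
    have b: "int (m - n) \<le> int (centre n m)" "int (centre n m) + int (m - n) < int (width n m)"
      using centre_bounds[OF m(2)] by linarith+
    have mn: "int (m - n) = 1 + \<bar>i\<bar> + int w"
      by (simp add: m_def)
    have s: "int s = i + int (centre n m)"
      using b mn by (simp add: s_def)
    have "s + w \<le> width n m"
      using s b mn by linarith
    moreover have "seed_point n (i + int j) = inflate_from n m (\<lambda>_. 1) (int (s + j))" if "j < w" for j
    proof -
      have "int (s + j) = i + int j + int (centre n m)"
        using s by simp
      then show ?thesis
        using b mn that by (subst seed_point_eq[OF m(2)]) (auto simp: add_ac)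
    qed
    ultimately have "sublist (factor_at (seed_point n) i w) (tau_comp rot_subst n m [1])"
      unfolding sublist_tau_comp_iff[OF m(2)] by blast
    moreover have "1 \<in> letters m"
      using modulus_ge_4[of m] by (simp add: letters_def)
    ultimately show ?thesis using m(1) by blast
  qed
  ultimately show ?thesis by (simp add: level_shift_def)
qed

section \<open>Letter-coboundaries vanish\<close>

lemma factor_at_add: "factor_at x i (v + w) = factor_at x i v @ factor_at x (i + int v) w"
  by (rule nth_equalityI) (auto simp: nth_append add.assoc)

lemma factor_at_1: "factor_at x i (Suc 0) = [x i]"
  by (simp add: factor_at_def)

lemma letter_coboundary_factor_add:
  assumes "letter_coboundary A Y c" "\<And>t. x t \<in> A"
  shows "c (factor_at x i (v + w)) = c (factor_at x i v) + c (factor_at x (i + int v) w)"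
proof -
  have "factor_at x j u \<in> lists A" for j u
    using assms(2) by (auto simp: factor_at_def)
  then show ?thesis
    using assms(1) by (simp add: letter_coboundary_def factor_at_add)
qed

text \<open>A word between two occurrences of a letter is a concatenation of return words to that letter:
  split off the first return and continue.\<close>

lemma letter_coboundary_cycle:
  assumes c: "letter_coboundary A Y c" and x: "x \<in> Y" "\<And>t. x t \<in> A"
  shows "x i = x (i + int d) \<Longrightarrow> c (factor_at x i d) = 0"
proof (induction d arbitrary: i rule: less_induct)
  case (less d)
  show ?case
  proof (cases "d = 0")
    case True
    then show ?thesis
      using c by (simp add: letter_coboundary_def factor_at_def)
  next
    case False
    define r where "r = (LEAST r. 0 < r \<and> x (i + int r) = x i)"
    have ex: "0 < d \<and> x (i + int d) = x i"
      using False less.prems by simp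
    have r: "0 < r" "x (i + int r) = x i" "r \<le> d"
      using LeastI[of "\<lambda>r. 0 < r \<and> x (i + int r) = x i", OF ex]
        Least_le[of "\<lambda>r. 0 < r \<and> x (i + int r) = x i", OF ex] unfolding r_def by auto
    have first: "x (i + int j) \<noteq> x i" if "0 < j" "j < r" for j
      using not_less_Least[of j "\<lambda>r. 0 < r \<and> x (i + int r) = x i"] that unfolding r_def by blast
    let ?w = "factor_at x i r"
    have fa: "?w @ [x i] = factor_at x i (r + 1)"
      using r(2) factor_at_add[of x i r 1] by (simp add: factor_at_1)
    have w: "?w = x i # factor_at x (i + 1) (r - 1)"
      using factor_at_add[of x i 1 "r - 1"] r(1) by (simp add: factor_at_1)
    have "x i \<notin> set (factor_at x (i + 1) (r - 1))"
    proof
      assume "x i \<in> set (factor_at x (i + 1) (r - 1))"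
      then obtain j where "j < r - 1" "x i = x (i + 1 + int j)"
        by (auto simp: factor_at_def)
      then show False
        using first[of "Suc j"] by (simp add: algebra_simps less_diff_conv)
    qed
    then have "count_list (?w @ [x i]) (x i) = 2"
      by (simp add: w count_notin)
    moreover have "prefix [x i] (?w @ [x i])" "suffix [x i] (?w @ [x i])"
      by (simp_all add: w suffix_def)
    moreover have "?w @ [x i] \<in> lang Y"
      unfolding fa using x(1) by (auto simp: lang_def)
    ultimately have "return_word Y (x i) ?w"
      by (simp add: return_word_def)
    then have "c ?w = 0"
      using c x(2)[of i] by (simp add: letter_coboundary_def)
    moreover have "c (factor_at x (i + int r) (d - r)) = 0"
      using r less.prems by (intro less.IH) auto
    ultimately show ?thesis
      using letter_coboundary_factor_add[of A Y c x, OF c x(2), of i r "d - r"] r(3) by simp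
  qed
qed

text \<open>The value of \<open>c\<close> on the word from \<open>B\<close> to \<open>t\<close> depends on the letter \<open>x t\<close> only, because words between
  two occurrences of the same letter contribute 0. The start \<open>B\<close> is a parameter because words have a
  beginning, and the transitions of interest may lie left of the origin.\<close>

lemma letter_coboundary_potential:
  fixes B :: int
  assumes c: "letter_coboundary A Y c" and x: "x \<in> Y" "\<And>t. x t \<in> A"
  obtains \<rho> :: "'a \<Rightarrow> real" where "\<And>t. B \<le> t \<Longrightarrow> \<rho> (x (t + 1)) = \<rho> (x t) + c [x t]"
proof -
  define S where "S t = c (factor_at x B (nat (t - B)))" for t
  have S: "S t = S s + c (factor_at x s (nat (t - s)))" if "B \<le> s" "s \<le> t" for s t
  proof -
    have "nat (t - B) = nat (s - B) + nat (t - s)" "B + int (nat (s - B)) = s"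
      using that by auto
    then show ?thesis
      using letter_coboundary_factor_add[of A Y c x, OF c x(2), of B "nat (s - B)" "nat (t - s)"]
      by (simp only: S_def)
  qed
  have S_le: "S t = S s" if "B \<le> s" "s \<le> t" "x s = x t" for s t
  proof -
    have "s + int (nat (t - s)) = t"
      using that(2) by simp
    then have "c (factor_at x s (nat (t - s))) = 0"
      using that(3) by (intro letter_coboundary_cycle[OF c x]) simp
    then show ?thesis
      using S[OF that(1,2)] by simp
  qed
  have S_eq: "S t = S s" if "B \<le> s" "B \<le> t" "x s = x t" for s t
  proof (cases "s \<le> t")
    case True
    then show ?thesis using S_le that by blast
  next
    case False
    then have "t \<le> s" by simp
    then show ?thesis using S_le[of t s] that by metis
  qed
  define \<rho> where "\<rho> a = S (SOME t. B \<le> t \<and> x t = a)" for a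
  have \<rho>: "\<rho> (x t) = S t" if "B \<le> t" for t
  proof -
    have "B \<le> (SOME s. B \<le> s \<and> x s = x t) \<and> x (SOME s. B \<le> s \<and> x s = x t) = x t"
      by (rule someI[of _ t]) (simp add: that)
    then show ?thesis
      unfolding \<rho>_def using that by (intro S_eq[symmetric]) auto
  qed
  have "\<rho> (x (t + 1)) = \<rho> (x t) + c [x t]" if "B \<le> t" for t
    using S[OF that, of "t + 1"] \<rho>[OF that] \<rho>[of "t + 1"] that by (simp add: factor_at_1)
  then show ?thesis by (rule that)
qed

text \<open>All steps inside images of letters occur: the image of 1 at level \<open>n + 1\<close> contains every letter of
  that level, and the seed point contains the image of this word.\<close>

lemma seed_point_step:
  assumes "j < modulus (Suc n)" "Suc i < len n"
  shows "\<exists>t \<ge> - int (centre n (n + 2)).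
    seed_point n t = image_letter n j i \<and> seed_point n (t + 1) = image_letter n j (Suc i)"
proof -
  let ?l = "int (len n)" and ?c = "int (centre n (n + 2))"
  obtain u where u: "u < len (Suc n)" "image_letter (Suc n) 1 u = j"
    using ex_image_letter[OF assms(1)] by blast
  \<comment> \<open>position \<open>i\<close> of the block with index \<open>u\<close>\<close>
  define t where "t = int u * ?l + int i"
  have w: "int (width n (n + 2)) = int (len (Suc n)) * ?l"
    by (simp add: width_Suc)
  have "(int u + 1) * ?l \<le> int (len (Suc n)) * ?l"
    using u(1) by (intro mult_right_mono) auto
  then have t: "0 \<le> t" "t + 1 < int (width n (n + 2))"
    using assms(2) unfolding w t_def by (auto simp: algebra_simps)
  have "t mod ?l = int i" "t div ?l = int u"
    using assms(2) by (simp_all add: t_def)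
  moreover have "inflate (Suc n) (\<lambda>_. 1) (int u) = j"
    using u by (simp add: inflate_def)
  moreover have "seed_point n (s - ?c) = inflate n (inflate (Suc n) (\<lambda>_. 1)) s"
    if "0 \<le> s" "s < int (width n (n + 2))" for s
    using that by (subst seed_point_eq[of n "n + 2"]) auto
  ultimately have "seed_point n (t - ?c) = image_letter n j i"
      "seed_point n (t + 1 - ?c) = image_letter n j (Suc i)"
    using t inflate_step[of t n i "inflate (Suc n) (\<lambda>_. 1)"] assms(2) by simp_all
  then show ?thesis
    using t(1) by (intro exI[of _ "t - ?c"]) (auto simp: algebra_simps)
qed

text \<open>The letter \<open>q\<close> is followed by \<open>q + p\<^sub>n\<close> inside images, and by \<open>q + p\<^sub>n - 1\<close> at the beginning of the
  image of an even letter. The potential thus agrees on \<open>q + p\<^sub>n\<close> and \<open>q + p\<^sub>n - 1\<close> for every \<open>q\<close>, so it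
  is constant, and \<open>c\<close>, being its increment, vanishes.\<close>

lemma letter_coboundary_eq_0:
  assumes c: "letter_coboundary (letters n) (level_shift letters rot_subst n) c"
    and a: "a \<in> letters n"
  shows "c [a] = 0"
proof -
  let ?k = "modulus n" and ?p = "rot_step n"
  have x: "seed_point n t \<in> letters n" for t
    using seed_point_in_level_shift[of n] by (simp add: level_shift_def)
  obtain \<rho> where \<rho>: "\<rho> (seed_point n (t + 1)) = \<rho> (seed_point n t) + c [seed_point n t]"
    if "- int (centre n (n + 2)) \<le> t" for t
    using letter_coboundary_potential[OF c seed_point_in_level_shift x] by metis
  have follow: "\<rho> (image_letter n j (Suc i)) = \<rho> (image_letter n j i) + c [image_letter n j i]"
    if "j < modulus (Suc n)" "Suc i < len n" for i j
    using seed_point_step[OF that] \<rho> by metis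
  have plain: "\<rho> ((q + ?p) mod ?k) = \<rho> q + c [q]" if q: "q < ?k" for q
  proof -
    \<comment> \<open>\<open>q - p\<^sub>n\<close> written without subtraction; the image of \<open>2 r\<close> has \<open>r + p\<^sub>n = q\<close> at position 1\<close>
    let ?r = "(q + (?k - 1) * ?p) mod ?k"
    have "2 * ?r < modulus (Suc n)"
      by (simp add: modulus_Suc)
    moreover have "image_letter n (2 * ?r) 1 = q"
    proof -
      have "q + (?k - 1) * ?p + ?p = q + ?k * ?p"
        using modulus_pos[of n] by (cases ?k) simp_all
      then have "(q + (?k - 1) * ?p + ?p) mod ?k = q"
        using q by (simp only: mod_mult_self2 mod_less)
      then show ?thesis
        by (simp add: image_letter_pos mod_simps)
    qed
    ultimately show ?thesis
      using follow[of "2 * ?r" 1] image_letter_plain_step[of 1 n "2 * ?r"] len_ge_5[of n] by simp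
  qed
  have skip: "\<rho> ((r + ?p) mod ?k) = \<rho> ((r + 1) mod ?k) + c [(r + 1) mod ?k]" if r: "r < ?k" for r
    using follow[of "2 * r" 0] r len_ge_5[of n]
    by (simp add: modulus_Suc image_letter_0 image_letter_pos)
  have succ: "\<rho> ((r + 1 + ?p) mod ?k) = \<rho> ((r + ?p) mod ?k)" for r
    using skip[of "r mod ?k"] plain[of "(r + 1) mod ?k"] by (simp add: mod_simps)
  have const: "\<rho> ((r + ?p) mod ?k) = \<rho> (?p mod ?k)" for r
  proof (induction r)
    case (Suc r)
    then show ?case using succ[of r] by simp
  qed simp
  have "\<rho> (q mod ?k) = \<rho> (?p mod ?k)" for q
  proof -
    have "q + (?k - 1) * ?p + ?p = q + ?k * ?p"
      using modulus_pos[of n] by (cases ?k) simp_all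
    then show ?thesis
      using const[of "q + (?k - 1) * ?p"] by (simp only: mod_mult_self2)
  qed
  from this[of a] this[of "a + ?p"] plain[of a] a show ?thesis
    by (simp add: letters_def)
qed

section \<open>Distance to the nearest integer\<close>

lemma dist_int_le: "x - y \<in> \<int> \<Longrightarrow> dist_int x \<le> \<bar>y\<bar>"
  using infdist_le[of "x - y" \<int> x] by (simp add: dist_int_def dist_real_def)

lemma dist_int_attained: "\<exists>y. x - y \<in> \<int> \<and> \<bar>y\<bar> = dist_int x"
proof -
  have "closed (\<int> :: real set)" "(\<int> :: real set) \<noteq> {}"
    by (auto intro: closed_Ints)
  then obtain z :: real where "z \<in> \<int>" "infdist x \<int> = dist x z"
    using infdist_attains_inf by blast
  then show ?thesis
    by (intro exI[of _ "x - z"]) (simp add: dist_int_def dist_real_def)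
qed

lemma dist_int_nonneg: "0 \<le> dist_int x"
  by (simp add: dist_int_def infdist_nonneg)

lemma dist_int_cong:
  assumes "x - y \<in> \<int>"
  shows "dist_int x = dist_int y"
proof -
  have *: "dist_int x \<le> dist_int y" if "x - y \<in> \<int>" for x y
  proof -
    obtain z where "y - z \<in> \<int>" "\<bar>z\<bar> = dist_int y"
      using dist_int_attained by blast
    with Ints_add[OF that this(1)] dist_int_le[of x z] show ?thesis by simp
  qed
  have "y - x \<in> \<int>"
    using Ints_minus[OF assms] by simp
  then show ?thesis
    using *[OF assms] *[of y x] by simp
qed

lemma dist_int_triangle: "dist_int (x + y) \<le> dist_int x + dist_int y"
proof -
  obtain u where u: "x - u \<in> \<int>" "\<bar>u\<bar> = dist_int x"
    using dist_int_attained by blast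
  obtain v where v: "y - v \<in> \<int>" "\<bar>v\<bar> = dist_int y"
    using dist_int_attained by blast
  have "(x + y) - (u + v) \<in> \<int>"
    using Ints_add[OF u(1) v(1)] by (simp add: algebra_simps)
  then show ?thesis
    using dist_int_le[of "x + y" "u + v"] u(2) v(2) by linarith
qed

lemma dist_int_minus: "dist_int (- x) = dist_int x"
proof -
  have "dist_int (- x) \<le> dist_int x" for x
  proof -
    obtain u where u: "x - u \<in> \<int>" "\<bar>u\<bar> = dist_int x"
      using dist_int_attained by blast
    from Ints_minus[OF u(1)] have "- x - (- u) \<in> \<int>" by simp
    then show ?thesis using dist_int_le[of "- x" "- u"] u(2) by simp
  qed
  from this[of x] this[of "- x"] show ?thesis by simp
qed

lemma dist_int_eq_0D: "dist_int x = 0 \<Longrightarrow> x \<in> \<int>"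
  using dist_int_attained[of x] by auto

lemma dist_int_ge_quarter:
  assumes "1/4 \<le> x" "x \<le> 3/4"
  shows "1/4 \<le> dist_int x"
proof -
  obtain y where y: "x - y \<in> \<int>" "\<bar>y\<bar> = dist_int x"
    using dist_int_attained by blast
  then obtain z :: int where z: "x - y = of_int z"
    by (auto elim: Ints_cases)
  show ?thesis
  proof (rule ccontr)
    assume "\<not> ?thesis"
    then have "\<bar>y\<bar> < 1/4" using y(2) by simp
    then have "0 < real_of_int z" "real_of_int z < 1"
      using assms z by linarith+
    then show False by simp
  qed
qed

lemma centered_frac_props: "centered_frac x \<in> {-1/2..<1/2} \<and> x - centered_frac x \<in> \<int>"
  unfolding centered_frac_def
proof (rule theI)
  let ?y = "x - of_int \<lfloor>x + 1/2\<rfloor>"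
  show "?y \<in> {-1/2..<1/2} \<and> x - ?y \<in> \<int>"
  proof (intro conjI)
    show "?y \<in> {-1/2..<1/2}"
      unfolding atLeastLessThan_iff by linarith
  qed simp
  fix y assume y: "y \<in> {-1/2..<1/2} \<and> x - y \<in> \<int>"
  then obtain z :: int where "x - y = of_int z" by (auto elim: Ints_cases)
  moreover from this y have "\<lfloor>x + 1/2\<rfloor> = z"
    by (intro floor_unique) auto
  ultimately show "y = ?y" by simp
qed

text \<open>Any other representative modulo 1 differs from the centered one by at least 1, hence has absolute
  value at least \<open>1/2\<close>.\<close>

lemma abs_centered_frac: "\<bar>centered_frac x\<bar> = dist_int x"
proof (rule antisym)
  let ?c = "centered_frac x"
  obtain y where y: "x - y \<in> \<int>" "\<bar>y\<bar> = dist_int x"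
    using dist_int_attained by blast
  have "(x - y) - (x - ?c) \<in> \<int>"
    using Ints_diff[OF y(1) conjunct2[OF centered_frac_props]] .
  then obtain z :: int where z: "(x - y) - (x - ?c) = of_int z"
    by (rule Ints_cases)
  have c: "- (1/2) \<le> ?c" "?c < 1/2"
    using centered_frac_props[of x] by auto
  show "\<bar>?c\<bar> \<le> dist_int x"
  proof (cases "z = 0")
    case True
    then show ?thesis using z y(2) by simp
  next
    case False
    then have "1 \<le> \<bar>real_of_int z\<bar>" by linarith
    then show ?thesis using z y(2) c by linarith
  qed
  show "dist_int x \<le> \<bar>?c\<bar>"
    using centered_frac_props by (intro dist_int_le) blast
qed

section \<open>The eigenvalue and its product with the heights\<close>

text \<open>With \<open>\<omega>\<^sub>n = p\<^sub>n/k\<^sub>n + e\<^sub>n\<close> the value of \<open>\<alpha> h\<^sub>n\<close> modulo 1, multiplication by the block length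
  \<open>l\<^sub>n = k\<^sub>n + 1\<close> fixes \<open>p\<^sub>n/k\<^sub>n\<close> modulo 1, while \<open>p\<^bsub>n+1\<^esub>/k\<^bsub>n+1\<^esub> = p\<^sub>n/k\<^sub>n + 1/k\<^bsub>n+1\<^esub>\<close>. Hence
  \<open>e\<^bsub>n+1\<^esub> = l\<^sub>n e\<^sub>n - 1/k\<^bsub>n+1\<^esub>\<close>; solving this recursion for bounded \<open>e\<^sub>n\<close> gives
  \<open>e\<^sub>n = h\<^sub>n \<Sum>\<^sub>m 1/(k\<^bsub>m+1\<^esub> h\<^bsub>m+1\<^esub>)\<close>, summed over \<open>m \<ge> n\<close>, and \<open>\<alpha>\<close> is \<open>p\<^sub>0/k\<^sub>0 + e\<^sub>0\<close> with \<open>p\<^sub>0/k\<^sub>0 = 1/4\<close>.\<close>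

definition alpha_term :: "nat \<Rightarrow> real" where
  "alpha_term m = 1 / (real (modulus (Suc m)) * real (width 0 (Suc m)))"

definition alpha :: real where
  "alpha = 1/4 + (\<Sum>m. alpha_term m)"

text \<open>The error \<open>e\<^sub>n\<close> of the approximation of \<open>\<alpha> h\<^sub>n\<close> by \<open>p\<^sub>n/k\<^sub>n\<close>.\<close>

definition defect :: "nat \<Rightarrow> real" where
  "defect n = real (width 0 n) * (\<Sum>m. alpha_term (m + n))"

lemma alpha_term_pos: "0 < alpha_term m"
  by (simp add: alpha_term_def)

lemma alpha_term_Suc: "alpha_term (Suc m) \<le> alpha_term m / 2"
proof -
  have "real (width 0 (Suc m)) * 1 \<le> real (width 0 (Suc m)) * real (len (Suc m))"
    using len_ge_5[of "Suc m"] by (intro mult_left_mono) auto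
  then have "real (width 0 (Suc m)) \<le> real (width 0 (Suc (Suc m)))"
    by (simp add: width_Suc[of 0 "Suc m"])
  then have "real (modulus (Suc m)) * real (width 0 (Suc m)) * 2
      \<le> real (modulus (Suc (Suc m))) * real (width 0 (Suc (Suc m)))"
    by (simp add: modulus_Suc[of "Suc m"])
  then have "1 / (real (modulus (Suc (Suc m))) * real (width 0 (Suc (Suc m))))
      \<le> 1 / (real (modulus (Suc m)) * real (width 0 (Suc m)) * 2)"
    by (intro divide_left_mono) auto
  then show ?thesis by (simp add: alpha_term_def)
qed

lemma alpha_term_le: "alpha_term (m + n) \<le> alpha_term n * (1/2) ^ m"
proof (induction m)
  case (Suc m)
  then show ?case using alpha_term_Suc[of "m + n"] by simp
qed simp

lemma summable_alpha_term: "summable (\<lambda>m. alpha_term (m + n))"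
proof (rule summable_comparison_test')
  show "summable (\<lambda>m. alpha_term n * (1/2) ^ m)"
    by (intro summable_mult summable_geometric) simp
  show "norm (alpha_term (m + n)) \<le> alpha_term n * (1/2) ^ m" for m
    using alpha_term_le[of m n] alpha_term_pos[of "m + n"] by simp
qed

lemma defect_nonneg: "0 \<le> defect n"
  unfolding defect_def
  by (intro mult_nonneg_nonneg suminf_nonneg summable_alpha_term less_imp_le[OF alpha_term_pos]) simp

text \<open>Along a whole image the errors add up to at most one unit \<open>1/k\<^sub>n\<close>, because the series is dominated by
  a geometric one of ratio \<open>1/2\<close>.\<close>

lemma defect_le: "real (len n) * defect n \<le> 1 / real (modulus n)"
proof -
  have "(\<Sum>m. alpha_term (m + n)) \<le> (\<Sum>m. alpha_term n * (1/2) ^ m)"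
    by (intro suminf_le alpha_term_le summable_alpha_term summable_mult summable_geometric) simp
  also have "\<dots> = alpha_term n * 2"
    by (simp add: suminf_mult summable_geometric suminf_geometric)
  finally have "real (len n) * defect n \<le> real (len n) * (real (width 0 n) * (alpha_term n * 2))"
    unfolding defect_def by (intro mult_left_mono) auto
  also have "\<dots> = 1 / real (modulus n)"
    by (simp add: alpha_term_def modulus_Suc width_Suc less_imp_neq[OF width_pos, symmetric] less_imp_neq[OF len_pos, symmetric])
  finally show ?thesis .
qed

lemma defect_Suc: "defect (Suc n) = real (len n) * defect n - 1 / real (modulus (Suc n))"
proof -
  have "(\<Sum>m. alpha_term (m + n)) = alpha_term n + (\<Sum>m. alpha_term (m + Suc n))"
    using suminf_split_head[OF summable_alpha_term[of n]] by simp
  then have "real (len n) * defect n = real (width 0 (Suc n)) * alpha_term n + defect (Suc n)"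
    by (simp add: defect_def width_Suc algebra_simps)
  moreover have "real (width 0 (Suc n)) * alpha_term n = 1 / real (modulus (Suc n))"
    using width_pos[of 0 "Suc n"] by (simp add: alpha_term_def del: width_pos)
  ultimately show ?thesis by simp
qed

lemma alpha_width:
  "alpha * real (width 0 n) - (real (rot_step n) / real (modulus n) + defect n) \<in> \<int>"
proof (induction n)
  case 0
  then show ?case
    by (simp add: alpha_def defect_def rot_step_def modulus_def)
next
  case (Suc n)
  let ?k = "real (modulus n)" and ?p = "real (rot_step n)" and ?l = "real (len n)"
  have k: "?k \<noteq> 0" by (simp add: less_imp_neq[OF modulus_pos, symmetric])
  have "real (rot_step (Suc n)) / real (modulus (Suc n)) = ?p / ?k + 1 / real (modulus (Suc n))"
    using k by (simp add: rot_step_Suc modulus_Suc field_simps)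
  moreover have "?l * (?p / ?k) = ?p + ?p / ?k"
    using k by (simp add: len_def field_simps)
  ultimately have "alpha * real (width 0 (Suc n)) -
        (real (rot_step (Suc n)) / real (modulus (Suc n)) + defect (Suc n))
      = ?l * (alpha * real (width 0 n) - (?p / ?k + defect n)) + ?p"
    by (simp add: defect_Suc width_Suc algebra_simps)
  also have "\<dots> \<in> \<int>"
    using Suc.IH by (intro Ints_add Ints_mult) auto
  finally show ?case .
qed

text \<open>Modulo 1 the number \<open>\<alpha> h\<^sub>n\<close> is \<open>1/2 - 1/k\<^sub>n\<close> plus an error between 0 and \<open>1/k\<^sub>n\<close>.\<close>

lemma dist_int_alpha_width: "1/4 \<le> dist_int (alpha * real (width 0 n))"
proof -
  let ?k = "real (modulus n)"
  have k: "4 \<le> ?k" using modulus_ge_4[of n] by linarith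
  have "1 * defect n \<le> real (len n) * defect n"
    using len_ge_5[of n] by (intro mult_right_mono defect_nonneg) auto
  with defect_le[of n] have d: "defect n \<le> 1 / ?k" by simp
  have "1 / ?k \<le> 1 / 4" using k by (intro divide_left_mono) auto
  moreover have "real (rot_step n) / ?k = 1/2 - 1 / ?k"
    using k arg_cong[OF modulus_eq_rot_step[of n], of real] by (simp add: field_simps)
  ultimately have "1/4 \<le> dist_int (real (rot_step n) / ?k + defect n)"
    using d defect_nonneg[of n] by (intro dist_int_ge_quarter) linarith+
  then show ?thesis
    using dist_int_cong[OF alpha_width[of n]] by simp
qed

section \<open>Angles of the towers\<close>

text \<open>Three sources of error, each of order \<open>1/k\<^sub>n\<close>: halving \<open>a\<close>, moving the first letter, and
  replacing the rotation by \<open>\<alpha> h\<^sub>n\<close> with the one by \<open>p\<^sub>n/k\<^sub>n\<close>.\<close>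

lemma angle_step:
  assumes "i < len n"
  shows "dist_int (real a / real (modulus (Suc n)) + alpha * real (width 0 n) * real i
      - real (image_letter n a i) / real (modulus n)) \<le> 2 / real (modulus n)"
proof -
  let ?k = "real (modulus n)" and ?p = "real (rot_step n)"
  have k: "0 < ?k" by simp
  have a: "real a = 2 * real (a div 2) + real (a mod 2)"
    by (metis div_mult_mod_eq mult.commute of_nat_add of_nat_mult of_nat_numeral)
  have eps: "0 \<le> real (a mod 2)" "real (a mod 2) \<le> 1"
    by auto
  have mod_int: "(real x - real (x mod modulus n)) / ?k \<in> \<int>" for x
  proof -
    have "real x = ?k * real (x div modulus n) + real (x mod modulus n)"
      by (metis mult_div_mod_eq of_nat_add of_nat_mult)
    then have "(real x - real (x mod modulus n)) / ?k = real (x div modulus n)"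
      using k by (simp add: field_simps)
    then show ?thesis by simp
  qed
  have alpha_i: "alpha * real (width 0 n) * real i - (?p / ?k + defect n) * real i \<in> \<int>"
    unfolding left_diff_distrib[symmetric] by (intro Ints_mult alpha_width) auto
  show ?thesis
  proof (cases "i = 0")
    case True
    define x where "x = a div 2 + 1 + a mod 2"
    have img: "image_letter n a i = x mod modulus n"
      by (simp add: True image_letter_0 x_def)
    have "real a / (2 * ?k) - real x / ?k = - ((1 + real (a mod 2) / 2) / ?k)"
      using k by (simp add: x_def a field_simps)
    then have "real a / real (modulus (Suc n)) + alpha * real (width 0 n) * real i
      - real (image_letter n a i) / ?k - (- ((1 + real (a mod 2) / 2) / ?k))
      = (real x - real (x mod modulus n)) / ?k"
      unfolding img by (simp add: True modulus_Suc diff_divide_distrib)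
    then have "dist_int (real a / real (modulus (Suc n)) + alpha * real (width 0 n) * real i
      - real (image_letter n a i) / ?k) \<le> \<bar>- ((1 + real (a mod 2) / 2) / ?k)\<bar>"
      using mod_int by (intro dist_int_le) simp
    also have "\<dots> = (1 + real (a mod 2) / 2) / ?k"
      using eps by simp
    also have "\<dots> \<le> 2 / ?k"
      using eps by (intro divide_right_mono) auto
    finally show ?thesis .
  next
    case False
    define x where "x = a div 2 + rot_step n * i"
    have img: "image_letter n a i = x mod modulus n"
      using False by (simp add: image_letter_pos x_def)
    let ?y = "real (a mod 2) / (2 * ?k) + defect n * real i"
    have "real a / (2 * ?k) + ?p / ?k * real i - real x / ?k = real (a mod 2) / (2 * ?k)"
      using k by (simp add: x_def a field_simps)
    then have "real a / real (modulus (Suc n)) + alpha * real (width 0 n) * real i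
      - real (image_letter n a i) / ?k - ?y
      = (real x - real (x mod modulus n)) / ?k
        + (alpha * real (width 0 n) * real i - (?p / ?k + defect n) * real i)"
      unfolding img by (simp add: modulus_Suc diff_divide_distrib algebra_simps)
    then have "dist_int (real a / real (modulus (Suc n)) + alpha * real (width 0 n) * real i
      - real (image_letter n a i) / ?k) \<le> \<bar>?y\<bar>"
      using Ints_add[OF mod_int[of x] alpha_i] by (intro dist_int_le) (simp only:)
    also have "\<bar>?y\<bar> = ?y"
      using k defect_nonneg[of n] by simp
    also have "\<dots> \<le> 1 / ?k + 1 / ?k"
    proof (rule add_mono)
      show "real (a mod 2) / (2 * ?k) \<le> 1 / ?k"
        using eps k by (simp add: field_simps)
      have "defect n * real i \<le> defect n * real (len n)"
        using assms by (intro mult_left_mono defect_nonneg) auto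
      then show "defect n * real i \<le> 1 / ?k"
        using defect_le[of n] by (simp add: mult.commute)
    qed
    also have "\<dots> = 2 / ?k" by simp
    finally show ?thesis .
  qed
qed

text \<open>The bounds \<open>2/k\<^sub>i = 2\<^bsup>-(i+1)\<^esup>\<close> of the single steps telescope to \<open>2\<^bsup>-n\<^esup> - 2\<^bsup>-m\<^esup>\<close>.\<close>

lemma angle_between_levels:
  "n \<le> m \<Longrightarrow>
    dist_int (real (f (t div int (width n m))) / real (modulus m)
      + alpha * real (width 0 n) * real_of_int (t mod int (width n m))
      - real (inflate_from n m f t) / real (modulus n)) \<le> (1/2) ^ n - (1/2) ^ m"
proof (induction m arbitrary: f rule: dec_induct)
  case base
  have "dist_int 0 \<le> \<bar>0\<bar>" by (rule dist_int_le) simp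
  then show ?case by simp
next
  case (step m)
  let ?w = "int (width n m)" and ?l = "int (len m)" and ?h = "real (width 0 n)"
  define i where "i = nat (t div ?w mod ?l)"
  have "0 \<le> t div ?w mod ?l" "t div ?w mod ?l < ?l"
    by simp_all
  then have i: "int i = t div ?w mod ?l" "i < len m"
    unfolding i_def by linarith+
  define a where "a = f (t div ?w div ?l)"
  have b: "inflate m f (t div ?w) = image_letter m a i"
    by (simp add: inflate_def a_def i_def)
  have h: "real (width 0 m) = ?h * real (width n m)"
    using width_mult[of 0 n m] step by simp
  have t: "t mod int (width n (Suc m)) = ?w * int i + t mod ?w"
    using step by (simp add: width_Suc zmod_zmult2_eq i)
  have f: "f (t div int (width n (Suc m))) = a"
    using step by (simp add: width_Suc zdiv_zmult2_eq a_def)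
  have IH: "dist_int (real (image_letter m a i) / real (modulus m)
      + alpha * ?h * real_of_int (t mod ?w)
      - real (inflate_from n (Suc m) f t) / real (modulus n)) \<le> (1/2) ^ n - (1/2) ^ m"
    using step.IH[of "inflate m f"] step.hyps by (simp add: b)
  have "2 / real (modulus m) = (1/2) ^ Suc m"
    by (simp add: modulus_def power_divide field_simps)
  then have "dist_int (real a / real (modulus (Suc m)) + alpha * real (width 0 m) * real i
      - real (image_letter m a i) / real (modulus m)) \<le> (1/2) ^ Suc m"
    using angle_step[OF i(2), of a] by simp
  moreover have "real a / real (modulus (Suc m)) + alpha * ?h * real_of_int (?w * int i + t mod ?w)
      - real (inflate_from n (Suc m) f t) / real (modulus n)
     = (real a / real (modulus (Suc m)) + alpha * real (width 0 m) * real i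
      - real (image_letter m a i) / real (modulus m))
      + (real (image_letter m a i) / real (modulus m) + alpha * ?h * real_of_int (t mod ?w)
      - real (inflate_from n (Suc m) f t) / real (modulus n))"
    unfolding h by (simp add: algebra_simps)
  ultimately have "dist_int (real a / real (modulus (Suc m))
      + alpha * ?h * real_of_int (?w * int i + t mod ?w)
      - real (inflate_from n (Suc m) f t) / real (modulus n))
      \<le> (1/2) ^ Suc m + ((1/2) ^ n - (1/2) ^ m)"
    by (simp only:) (rule order_trans[OF dist_int_triangle add_mono[OF _ IH]])
  then show ?case
    unfolding f t by (simp add: field_simps)
qed

section \<open>The eigenfunction\<close>

text \<open>The window of radius \<open>N\<close> around the origin of \<open>y\<close> is found around position \<open>s\<close> in the image of
  some letter, and \<open>G\<close> is the angle that this occurrence assigns to the origin. Such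
  occurrences take the place of a bi-infinite desubstitution of \<open>y\<close>.\<close>

definition sighting :: "nat \<Rightarrow> (int \<Rightarrow> nat) \<Rightarrow> real \<Rightarrow> bool" where
  "sighting N y G \<longleftrightarrow> (\<exists>m a s. int N \<le> s \<and> s + int N < int (width 0 m)
     \<and> (\<forall>t. \<bar>t\<bar> \<le> int N \<longrightarrow> y t = inflate_from 0 m (\<lambda>_. a) (s + t))
     \<and> G = real a / real (modulus m) + alpha * real_of_int s)"

lemma sighting_mono:
  assumes "sighting N y G" "M \<le> N"
  shows "sighting M y G"
proof -
  obtain m a s where "int N \<le> s" "s + int N < int (width 0 m)"
    "\<forall>t. \<bar>t\<bar> \<le> int N \<longrightarrow> y t = inflate_from 0 m (\<lambda>_. a) (s + t)"
    "G = real a / real (modulus m) + alpha * real_of_int s"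
    using assms(1) unfolding sighting_def by blast
  then show ?thesis
    unfolding sighting_def using assms(2)
    by (intro exI[of _ m] exI[of _ a] exI[of _ s]) auto
qed

lemma sighting_cong:
  "(\<And>t. \<bar>t\<bar> \<le> int N \<Longrightarrow> y t = y' t) \<Longrightarrow> sighting N y G \<longleftrightarrow> sighting N y' G"
  unfolding sighting_def by simp

lemma sighting_shift:
  assumes "sighting (Suc N) y G"
  shows "sighting N (shift y) (G + alpha)"
proof -
  obtain m a s where s: "int (Suc N) \<le> s" "s + int (Suc N) < int (width 0 m)"
    and y: "\<And>t. \<bar>t\<bar> \<le> int (Suc N) \<Longrightarrow> y t = inflate_from 0 m (\<lambda>_. a) (s + t)"
    and G: "G = real a / real (modulus m) + alpha * real_of_int s"
    using assms unfolding sighting_def by blast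
  have "shift y t = inflate_from 0 m (\<lambda>_. a) (s + 1 + t)" if "\<bar>t\<bar> \<le> int N" for t
    using y[of "t + 1"] that by (simp add: shift_def algebra_simps)
  moreover have "G + alpha = real a / real (modulus m) + alpha * real_of_int (s + 1)"
    by (simp add: G algebra_simps)
  ultimately show ?thesis
    unfolding sighting_def using s by (intro exI[of _ m] exI[of _ a] exI[of _ "s + 1"]) auto
qed

lemma ex_sighting:
  assumes "y \<in> level_shift letters rot_subst 0"
  shows "\<exists>G. sighting N y G"
proof -
  obtain m a where "sublist (factor_at y (- int N) (2 * N + 1)) (tau_comp rot_subst 0 m [a])"
    using assms unfolding level_shift_def by blast
  then obtain s where s: "s + (2 * N + 1) \<le> width 0 m"
    and y: "\<And>j. j < 2 * N + 1 \<Longrightarrow> y (- int N + int j) = inflate_from 0 m (\<lambda>_. a) (int (s + j))"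
    by (auto simp: sublist_tau_comp_iff)
  have "y t = inflate_from 0 m (\<lambda>_. a) (int (s + N) + t)" if "\<bar>t\<bar> \<le> int N" for t
  proof -
    have "nat (int N + t) < 2 * N + 1" "int (nat (int N + t)) = int N + t"
      using that by linarith+
    then show ?thesis
      using y[of "nat (int N + t)"] by (simp add: add_ac)
  qed
  moreover have "int (s + N) + int N < int (width 0 m)"
    using s by linarith
  ultimately have "sighting N y (real a / real (modulus m) + alpha * real_of_int (int (s + N)))"
    unfolding sighting_def by (intro exI[of _ m] exI[of _ a] exI[of _ "int (s + N)"]) auto
  then show ?thesis by blast
qed

text \<open>Reading the same position from level \<open>m\<close> or from level \<open>n\<close> changes the angle by at most \<open>2\<^bsup>-n\<^esup>\<close>.\<close>

lemma angle_from_level: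
  fixes s :: int
  assumes "n \<le> m" "0 \<le> s" "s < int (width 0 m)"
  shows "dist_int ((real a / real (modulus m) + alpha * real_of_int s)
      - (real (inflate_from n m (\<lambda>_. a) (s div int (width 0 n))) / real (modulus n)
         + alpha * real_of_int (s mod int (width 0 n)))) \<le> (1/2) ^ n"
proof -
  let ?h = "int (width 0 n)"
  let ?t = "s div ?h"
  have "int (width 0 m) = ?h * int (width n m)"
    using width_mult[of 0 n m] assms(1) by simp
  then have "?h * ?t < ?h * int (width n m)"
    using assms(3) mult_div_mod_eq[of ?h s] pos_mod_sign[of ?h s] width_pos[of 0 n] by linarith
  then have "?t < int (width n m)"
    by simp
  then have t: "?t mod int (width n m) = ?t"
    using assms(2) by (intro mod_pos_pos_trivial) (simp_all add: pos_imp_zdiv_nonneg_iff)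
  have "real_of_int s = real_of_int (?h * ?t + s mod ?h)"
    by simp
  then have s: "real_of_int s = real (width 0 n) * real_of_int ?t + real_of_int (s mod ?h)"
    by (simp only: of_int_add of_int_mult of_int_of_nat_eq)
  have eq: "(real a / real (modulus m) + alpha * real_of_int s)
      - (real (inflate_from n m (\<lambda>_. a) ?t) / real (modulus n) + alpha * real_of_int (s mod ?h))
    = real a / real (modulus m) + alpha * real (width 0 n) * real_of_int ?t
      - real (inflate_from n m (\<lambda>_. a) ?t) / real (modulus n)"
    unfolding s by (simp add: algebra_simps)
  have "dist_int (real a / real (modulus m) + alpha * real (width 0 n) * real_of_int ?t
      - real (inflate_from n m (\<lambda>_. a) ?t) / real (modulus n)) \<le> (1/2) ^ n - (1/2) ^ m"
    using angle_between_levels[OF assms(1), of "\<lambda>_. a" ?t] by (simp only: t)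
  also have "\<dots> \<le> (1/2) ^ n" by simp
  finally show ?thesis unfolding eq .
qed

text \<open>Windows longer than the towers of level \<open>n\<close> only occur in letters of deeper levels. By
  recognizability two occurrences of such a window have the same letter and the same remainder at
  level \<open>n\<close>, so both angles are close to the one computed from level \<open>n\<close>.\<close>

lemma sightings_close:
  "\<exists>N. \<forall>y G G'. sighting N y G \<longrightarrow> sighting N y G' \<longrightarrow> dist_int (G - G') \<le> 2 * (1/2) ^ n"
proof -
  let ?h = "width 0 n"
  obtain N where N: "s mod int ?h = s' mod int ?h \<and> f (s div int ?h) = f' (s' div int ?h)"
    if "\<And>t. f t < modulus n" "\<And>t. f' t < modulus n"
      "\<And>u. \<bar>u\<bar> \<le> int N \<Longrightarrow> inflate_from 0 n f (s + u) = inflate_from 0 n f' (s' + u)"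
    for f f' s s'
    using local_recognizability[of n] by blast
  let ?M = "N + ?h"
  have "dist_int (G - G') \<le> 2 * (1/2) ^ n" if G: "sighting ?M y G" and G': "sighting ?M y G'" for y G G'
  proof -
    \<comment> \<open>the window has more than \<open>h\<^sub>n\<close> letters and fits into the image of one letter of level \<open>m\<close>\<close>
    have deep: "n < m" if "int ?M \<le> s" "s + int ?M < int (width 0 m)" for m s
    proof (rule ccontr)
      assume "\<not> n < m"
      then have "?h = width 0 m * width m n"
        using width_mult[of 0 m n] by simp
      moreover have "width 0 m * 1 \<le> width 0 m * width m n"
        by (intro mult_le_mono) (simp_all add: Suc_le_eq)
      ultimately show False
        using that by simp
    qed
    obtain m a s where s: "int ?M \<le> s" "s + int ?M < int (width 0 m)"
      and y: "\<And>t. \<bar>t\<bar> \<le> int ?M \<Longrightarrow> y t = inflate_from 0 m (\<lambda>_. a) (s + t)"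
      and Geq: "G = real a / real (modulus m) + alpha * real_of_int s"
      using G unfolding sighting_def by blast
    obtain m' a' s' where s': "int ?M \<le> s'" "s' + int ?M < int (width 0 m')"
      and y': "\<And>t. \<bar>t\<bar> \<le> int ?M \<Longrightarrow> y t = inflate_from 0 m' (\<lambda>_. a') (s' + t)"
      and Geq': "G' = real a' / real (modulus m') + alpha * real_of_int s'"
      using G' unfolding sighting_def by blast
    have m: "n < m" "n < m'"
      using deep[OF s] deep[OF s'] .
    let ?f = "inflate_from n m (\<lambda>_. a)" and ?f' = "inflate_from n m' (\<lambda>_. a')"
    have "inflate_from 0 n ?f (s + u) = inflate_from 0 n ?f' (s' + u)" if "\<bar>u\<bar> \<le> int N" for u
      using y[of u] y'[of u] that m inflate_from_compose[of 0 n m] inflate_from_compose[of 0 n m']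
      by simp
    then have same: "s mod int ?h = s' mod int ?h" "?f (s div int ?h) = ?f' (s' div int ?h)"
      using N[of ?f ?f' s s'] m by (simp_all add: inflate_from_less_strict)
    let ?z = "real (?f (s div int ?h)) / real (modulus n) + alpha * real_of_int (s mod int ?h)"
    have "dist_int (G - ?z) \<le> (1/2) ^ n"
      unfolding Geq using s m by (intro angle_from_level) auto
    moreover have "dist_int (G' - ?z) \<le> (1/2) ^ n"
      unfolding Geq' same using s' m by (intro angle_from_level) auto
    moreover have "dist_int (G - G') \<le> dist_int (G - ?z) + dist_int (- (G' - ?z))"
      using dist_int_triangle[of "G - ?z" "- (G' - ?z)"] by simp
    ultimately show ?thesis
      by (simp add: dist_int_minus del: minus_diff_eq)
  qed
  then show ?thesis by blast
qed

lemma open_window: "open {y :: int \<Rightarrow> nat. \<forall>t. \<bar>t\<bar> \<le> int N \<longrightarrow> y t = x t}"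
proof -
  have "{y :: int \<Rightarrow> nat. \<forall>t. \<bar>t\<bar> \<le> int N \<longrightarrow> y t = x t} =
      (\<Inter>t\<in>{- int N..int N}. (\<lambda>y. y t) -` {x t})"
    by (auto simp: abs_le_iff)
  also have "open \<dots>"
    by (intro open_INT ballI finite_atLeastAtMost_int open_vimage open_discrete continuous_on_product_coordinates)
  finally show ?thesis .
qed

lemma continuous_on_window:
  fixes f :: "(int \<Rightarrow> nat) \<Rightarrow> 'b::topological_space"
  assumes "\<And>x y. (\<And>t. \<bar>t\<bar> \<le> int N \<Longrightarrow> x t = y t) \<Longrightarrow> f x = f y"
  shows "continuous_on X f"
proof -
  have "open (f -` U)" for U
    unfolding open_subopen[of "f -` U"]
  proof
    fix x assume x: "x \<in> f -` U"
    have "{y. \<forall>t. \<bar>t\<bar> \<le> int N \<longrightarrow> y t = x t} \<subseteq> f -` U"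
    proof
      fix y :: "int \<Rightarrow> nat"
      assume "y \<in> {y. \<forall>t. \<bar>t\<bar> \<le> int N \<longrightarrow> y t = x t}"
      then have "f y = f x" by (intro assms) simp
      with x show "y \<in> f -` U" by simp
    qed
    then show "\<exists>T. open T \<and> x \<in> T \<and> T \<subseteq> f -` U"
      using open_window[of N x] by blast
  qed
  then have "continuous_on UNIV f"
    using continuous_on_open_vimage[of UNIV f] by simp
  then show ?thesis by (rule continuous_on_subset) simp
qed

lemma continuous_mod_Z: "continuous_on S mod_Z"
  by (rule continuous_on_subset[of UNIV])
    (auto simp: continuous_on_open_vimage open_RmodZ_def)

text \<open>Choose an angle \<open>g n y\<close> for each window size; consecutive choices are summably close modulo 1.
  Replacing their differences by the centered representatives gives real functions that converge
  uniformly. They depend on finite windows, so the limit is continuous; it satisfies the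
  eigenvalue equation because shifting an occurrence by one adds exactly \<open>\<alpha>\<close> to its angle.\<close>

lemma eigenvalue_alpha: "eigenvalue (level_shift letters rot_subst 0) alpha"
proof -
  let ?X = "level_shift letters rot_subst 0"
  have "\<forall>n. \<exists>N. \<forall>y G G'. sighting N y G \<longrightarrow> sighting N y G' \<longrightarrow> dist_int (G - G') \<le> 2 * (1/2) ^ n"
    using sightings_close by blast
  then obtain N0 where N0: "\<And>n y G G'. sighting (N0 n) y G \<Longrightarrow> sighting (N0 n) y G' \<Longrightarrow>
      dist_int (G - G') \<le> 2 * (1/2) ^ n"
    by metis
  \<comment> \<open>partial sums make the window sizes increasing, so that later choices can be compared with earlier ones\<close>
  define N where "N n = (\<Sum>i\<le>n. N0 i)" for n
  have N_mono: "N n \<le> N (Suc n)" and N_ge: "N0 n \<le> N n" for n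
    by (simp_all add: N_def member_le_sum)
  have close: "dist_int (G - G') \<le> 2 * (1/2) ^ n" if "sighting (N n) y G" "sighting (N n) y G'" for n y G G'
    using that sighting_mono[OF _ N_ge] N0 by blast
  define g where "g n y = (SOME G. sighting (N n) y G)" for n y
  have g: "sighting (N n) y (g n y)" if "y \<in> ?X" for n y
    unfolding g_def using ex_sighting[OF that] by (rule someI_ex)
  have g_local: "g n x = g n y" if "\<And>t. \<bar>t\<bar> \<le> int (N n) \<Longrightarrow> x t = y t" for n x y
  proof -
    have "sighting (N n) x = sighting (N n) y"
      by (rule ext) (rule sighting_cong[OF that])
    then show ?thesis by (simp add: g_def)
  qed
  define d where "d n y = centered_frac (g (Suc n) y - g n y)" for n y
  have d_le: "\<bar>d n y\<bar> \<le> 2 * (1/2) ^ n" if y: "y \<in> ?X" for n y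
  proof -
    have "dist_int (g (Suc n) y - g n y) \<le> 2 * (1/2) ^ n"
      by (intro close[of _ y] g[OF y] sighting_mono[OF g[OF y] N_mono])
    then show ?thesis
      unfolding d_def abs_centered_frac .
  qed
  define \<Gamma> where "\<Gamma> y = g 0 y + (\<Sum>n. d n y)" for y
  have unif: "uniform_limit ?X (\<lambda>n y. \<Sum>i<n. d i y) (\<lambda>y. \<Sum>n. d n y) sequentially"
  proof (rule Weierstrass_m_test)
    show "summable (\<lambda>n. 2 * (1/2::real) ^ n)"
      by (intro summable_mult summable_geometric) simp
  qed (simp add: d_le)
  have d_cont: "continuous_on ?X (d n)" for n
  proof (rule continuous_on_window)
    fix x y :: "int \<Rightarrow> nat"
    assume *: "\<And>t. \<bar>t\<bar> \<le> int (N (Suc n)) \<Longrightarrow> x t = y t"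
    have "g (Suc n) x = g (Suc n) y" by (rule g_local) (rule *)
    moreover have "g n x = g n y"
      using N_mono[of n] by (intro g_local *) linarith
    ultimately show "d n x = d n y" by (simp add: d_def)
  qed
  have "continuous_on ?X (\<lambda>y. \<Sum>n. d n y)"
    by (rule uniform_limit_theorem[OF _ unif]) (auto intro!: always_eventually continuous_on_sum d_cont)
  moreover have "continuous_on ?X (g 0)"
    by (rule continuous_on_window) (rule g_local)
  ultimately have \<Gamma>_cont: "continuous_on ?X \<Gamma>"
    unfolding \<Gamma>_def by (intro continuous_on_add)
  define P where "P n y = g 0 y + (\<Sum>i<n. d i y)" for n y
  have P_int: "P n y - g n y \<in> \<int>" for n y
  proof (induction n)
    case (Suc n)
    have "P (Suc n) y - g (Suc n) y = (P n y - g n y) - (g (Suc n) y - g n y - d n y)"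
      by (simp add: P_def)
    also have "\<dots> \<in> \<int>"
      unfolding d_def by (intro Ints_diff[OF Suc.IH] conjunct2[OF centered_frac_props])
    finally show ?case .
  qed (simp add: P_def)
  have P_lim: "(\<lambda>n. P n y) \<longlonglongrightarrow> \<Gamma> y" if "y \<in> ?X" for y
    unfolding P_def \<Gamma>_def by (intro tendsto_add tendsto_const tendsto_uniform_limitI[OF unif that])
  have shift_X: "shift y \<in> ?X" if "y \<in> ?X" for y
  proof -
    have "factor_at (shift y) i l = factor_at y (i + 1) l" for i l
      by (simp add: factor_at_def shift_def add_ac)
    then show ?thesis
      using that by (simp add: level_shift_def) (simp add: shift_def)
  qed
  have \<Gamma>_shift: "\<Gamma> (shift y) - (\<Gamma> y + alpha) \<in> \<int>" if y: "y \<in> ?X" for y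
  proof -
    have bound: "dist_int (P n (shift y) - (P n y + alpha)) \<le> 4 * (1/2) ^ n" for n
    proof -
      \<comment> \<open>an occurrence of a window one larger also shows the window of the shifted point\<close>
      obtain G where G: "sighting (Suc (N n)) y G"
        using ex_sighting[OF y] by blast
      have 1: "dist_int (g n (shift y) - (G + alpha)) \<le> 2 * (1/2) ^ n"
        by (intro close[of _ "shift y"] g shift_X y sighting_shift G)
      have 2: "dist_int (G - g n y) \<le> 2 * (1/2) ^ n"
        by (intro close[of _ y] g y sighting_mono[OF G]) simp
      have "(P n (shift y) - g n (shift y)) - (P n y - g n y) \<in> \<int>"
        by (intro Ints_diff P_int)
      then have "dist_int (P n (shift y) - (P n y + alpha)) = dist_int (g n (shift y) - (g n y + alpha))"
        by (intro dist_int_cong) (simp add: algebra_simps)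
      also have "g n (shift y) - (g n y + alpha) = (g n (shift y) - (G + alpha)) + (G - g n y)"
        by simp
      finally show ?thesis
        using dist_int_triangle[of "g n (shift y) - (G + alpha)" "G - g n y"] 1 2 by linarith
    qed
    have "(\<lambda>n. P n (shift y) - (P n y + alpha)) \<longlonglongrightarrow> \<Gamma> (shift y) - (\<Gamma> y + alpha)"
      by (intro tendsto_intros P_lim shift_X y)
    then have "(\<lambda>n. dist_int (P n (shift y) - (P n y + alpha)))
        \<longlonglongrightarrow> dist_int (\<Gamma> (shift y) - (\<Gamma> y + alpha))"
      unfolding dist_int_def by (rule tendsto_infdist)
    moreover have "(\<lambda>n. 4 * (1/2::real) ^ n) \<longlonglongrightarrow> 4 * 0"
      by (intro tendsto_mult tendsto_const LIMSEQ_power_zero) simp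
    ultimately have "dist_int (\<Gamma> (shift y) - (\<Gamma> y + alpha)) \<le> 4 * 0"
      by (rule LIMSEQ_le) (simp add: bound)
    then show ?thesis
      using dist_int_nonneg[of "\<Gamma> (shift y) - (\<Gamma> y + alpha)"] by (intro dist_int_eq_0D) simp
  qed
  show ?thesis
    unfolding eigenvalue_def
  proof (intro exI conjI ballI)
    show "continuous_on ?X (mod_Z \<circ> \<Gamma>)"
      by (intro continuous_on_compose \<Gamma>_cont continuous_mod_Z)
    show "(mod_Z \<circ> \<Gamma>) (shift y) = (mod_Z \<circ> \<Gamma>) y + mod_Z alpha" if "y \<in> ?X" for y
      using \<Gamma>_shift[OF that] by (simp add: plus_RmodZ.abs_eq RmodZ.abs_eq_iff)
  qed
qed

section \<open>Failure of all conditions on letter-coboundaries\<close>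

lemma lists_tau_comp_letter:
  assumes "n \<le> m" "a \<in> letters m"
  shows "tau_comp rot_subst n m [a] \<in> lists (letters n)"
  using assms inflate_from_less[OF assms(1), of "\<lambda>_. a"]
  by (auto simp: in_set_conv_nth length_tau_comp nth_tau_comp_letter letters_def)

lemma letter_coboundary_lists_eq_0:
  assumes c: "letter_coboundary (letters n) (level_shift letters rot_subst n) c"
    and "u \<in> lists (letters n)"
  shows "c u = 0"
  using assms(2)
proof (induction u)
  case Nil
  then show ?case using c by (simp add: letter_coboundary_def)
next
  case (Cons a u)
  then have "[a] \<in> lists (letters n)" by simp
  then have "c ([a] @ u) = c [a] + c u"
    using c Cons.hyps unfolding letter_coboundary_def by blast
  then show ?case
    using Cons letter_coboundary_eq_0[OF c] by simp
qed

lemma ex_letter_lang: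
  "\<exists>a\<in>letters n. [a] \<in> lang (level_shift letters rot_subst n)"
proof
  show "seed_point n 0 \<in> letters n"
    using seed_point_in_level_shift[of n] by (simp add: level_shift_def)
  have "[seed_point n 0] = factor_at (seed_point n) 0 1"
    by (simp add: factor_at_1)
  then show "[seed_point n 0] \<in> lang (level_shift letters rot_subst n)"
    unfolding lang_def using seed_point_in_level_shift by blast
qed

text \<open>The coboundary vanishes, and all letters have the same height.\<close>

lemma dist_int_coboundary_height_letter:
  assumes "letter_coboundary (letters n) (level_shift letters rot_subst n) c"
    and "n \<le> m" "a \<in> letters m"
  shows "1/4 \<le> dist_int (c (tau_comp rot_subst n m [a]) - alpha * real (height rot_subst m [a]))"
  using letter_coboundary_lists_eq_0[OF assms(1) lists_tau_comp_letter[OF assms(2,3)]]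
    dist_int_alpha_width[of m] by (simp add: height_rot_subst dist_int_minus)

text \<open>All letters of level \<open>n\<close> have the same centered fraction, and its multiple by the number of letters
  agrees with \<open>- \<alpha> h\<^sub>m(a)\<close> modulo 1.\<close>

lemma frac_morphism_letter:
  assumes c: "letter_coboundary (letters n) (level_shift letters rot_subst n) c"
    and m: "n \<le> m" "a \<in> letters m"
  shows "1/4 \<le> \<bar>frac_morphism rot_subst alpha n c (tau_comp rot_subst n m [a])\<bar>"
proof -
  let ?u = "tau_comp rot_subst n m [a]"
  let ?x = "- (alpha * real (width 0 n))"
  have "map (\<lambda>b. centered_frac (c [b] - alpha * real (height rot_subst n [b]))) ?u
      = map (\<lambda>_. centered_frac ?x) ?u"
    using lists_tau_comp_letter[OF m] letter_coboundary_eq_0[OF c]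
    by (auto simp: height_rot_subst)
  then have eq: "frac_morphism rot_subst alpha n c ?u = real (width n m) * centered_frac ?x"
    using m(1) unfolding frac_morphism_def
    by (simp only: sum_list_triv length_tau_comp) simp
  have "real (width n m) * (?x - centered_frac ?x) \<in> \<int>"
    by (intro Ints_mult conjunct2[OF centered_frac_props]) auto
  moreover have "real (width 0 m) = real (width 0 n) * real (width n m)"
    using width_mult[of 0 n m] m(1) by simp
  ultimately have "- (alpha * real (width 0 m)) - real (width n m) * centered_frac ?x \<in> \<int>"
    by (simp add: algebra_simps)
  then have "dist_int (- (alpha * real (width 0 m))) \<le> \<bar>real (width n m) * centered_frac ?x\<bar>"
    by (rule dist_int_le)
  then show ?thesis
    using dist_int_alpha_width[of m] by (simp only: eq dist_int_minus)
qed

lemma not_LIMSEQ_0_if_ge: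
  fixes f :: "nat \<Rightarrow> ereal"
  assumes "\<And>m. n \<le> m \<Longrightarrow> ereal (1/4) \<le> f m"
  shows "\<not> f \<longlonglongrightarrow> 0"
proof
  assume "f \<longlonglongrightarrow> 0"
  then have "ereal (1/4) \<le> 0"
    by (rule LIMSEQ_le_const) (use assms in blast)
  then show False by simp
qed

theorem theorem9p2:
  "\<exists>(A :: nat \<Rightarrow> nat set) (\<tau> :: nat \<Rightarrow> nat list \<Rightarrow> nat list) (\<alpha> :: real).
     directive_sequence A \<tau> \<and> recognizable_seq A \<tau> \<and> primitive_seq A \<tau>
     \<and> eigenvalue (level_shift A \<tau> 0) \<alpha>
     \<and> (\<forall>c. (\<forall>n. letter_coboundary (A n) (level_shift A \<tau> n) (c n)) \<longrightarrow>
          liminf (\<lambda>n. ereal (Max ((\<lambda>a. dist_int (c n [a] - \<alpha> * real (height \<tau> n [a]))) ` A n))) > 0)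
     \<and> \<not> (\<exists>n c. letter_coboundary (A n) (level_shift A \<tau> n) c \<and>
          (\<lambda>m. SUP u\<in>lang (level_shift A \<tau> m).
             ereal (dist_int (c (tau_comp \<tau> n m u) - \<alpha> * real (height \<tau> m u)))) \<longlonglongrightarrow> 0)
     \<and> \<not> (\<exists>n c. letter_coboundary (A n) (level_shift A \<tau> n) c \<and>
          (\<lambda>m. SUP u\<in>lang (level_shift A \<tau> m).
             ereal \<bar>frac_morphism \<tau> \<alpha> n c (tau_comp \<tau> n m u)\<bar>) \<longlonglongrightarrow> 0)
     \<and> \<not> (\<exists>c. (\<forall>n. letter_coboundary (A n) (level_shift A \<tau> n) (c n)) \<and>
          summable (\<lambda>n. Max {dist_int (c n u - \<alpha> * real (height \<tau> n u)) | a u.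
             a \<in> A (n + 2) \<and> prefix u (tau_comp \<tau> n (n + 2) [a])}))"
proof (intro exI[of _ letters] exI[of _ rot_subst] exI[of _ alpha] conjI allI impI notI)
  show "directive_sequence letters rot_subst" "recognizable_seq letters rot_subst"
    "primitive_seq letters rot_subst" "eigenvalue (level_shift letters rot_subst 0) alpha"
    by (rule directive_sequence_rot_subst recognizable_seq_rot_subst primitive_seq_rot_subst
        eigenvalue_alpha)+
next
  fix c :: "nat \<Rightarrow> nat list \<Rightarrow> real"
  assume c: "\<forall>n. letter_coboundary (letters n) (level_shift letters rot_subst n) (c n)"
  let ?M = "\<lambda>n. Max ((\<lambda>a. dist_int (c n [a] - alpha * real (height rot_subst n [a]))) ` letters n)"
  have "1/4 \<le> ?M n" for n
  proof -
    have 0: "0 \<in> letters n" by (simp add: letters_def)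
    have "1/4 \<le> dist_int (c n [0] - alpha * real (height rot_subst n [0]))"
      using dist_int_coboundary_height_letter[OF c[rule_format], of n n 0] 0 by simp
    also have "\<dots> \<le> ?M n"
      using 0 by (intro Max_ge) (auto simp: letters_def)
    finally show ?thesis .
  qed
  then have "ereal (1/4) \<le> liminf (\<lambda>n. ereal (?M n))"
    by (intro Liminf_bounded) simp
  then show "0 < liminf (\<lambda>n. ereal (?M n))"
    by (rule less_le_trans[rotated]) simp
next
  assume "\<exists>n c. letter_coboundary (letters n) (level_shift letters rot_subst n) c \<and>
      (\<lambda>m. SUP u\<in>lang (level_shift letters rot_subst m).
         ereal (dist_int (c (tau_comp rot_subst n m u) - alpha * real (height rot_subst m u)))) \<longlonglongrightarrow> 0"
  then obtain n c where c: "letter_coboundary (letters n) (level_shift letters rot_subst n) c"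
    and lim: "(\<lambda>m. SUP u\<in>lang (level_shift letters rot_subst m).
         ereal (dist_int (c (tau_comp rot_subst n m u) - alpha * real (height rot_subst m u)))) \<longlonglongrightarrow> 0"
    by blast
  have ge: "ereal (1/4) \<le> (SUP u\<in>lang (level_shift letters rot_subst m).
         ereal (dist_int (c (tau_comp rot_subst n m u) - alpha * real (height rot_subst m u))))"
    if "n \<le> m" for m
  proof -
    obtain a where "a \<in> letters m" "[a] \<in> lang (level_shift letters rot_subst m)"
      using ex_letter_lang by blast
    then show ?thesis
      using dist_int_coboundary_height_letter[OF c that] by (intro SUP_upper2[of "[a]"]) auto
  qed
  show False
    using not_LIMSEQ_0_if_ge[OF ge] lim by (rule notE)
next
  assume "\<exists>n c. letter_coboundary (letters n) (level_shift letters rot_subst n) c \<and>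
      (\<lambda>m. SUP u\<in>lang (level_shift letters rot_subst m).
         ereal \<bar>frac_morphism rot_subst alpha n c (tau_comp rot_subst n m u)\<bar>) \<longlonglongrightarrow> 0"
  then obtain n c where c: "letter_coboundary (letters n) (level_shift letters rot_subst n) c"
    and lim: "(\<lambda>m. SUP u\<in>lang (level_shift letters rot_subst m).
         ereal \<bar>frac_morphism rot_subst alpha n c (tau_comp rot_subst n m u)\<bar>) \<longlonglongrightarrow> 0"
    by blast
  have ge: "ereal (1/4) \<le> (SUP u\<in>lang (level_shift letters rot_subst m).
         ereal \<bar>frac_morphism rot_subst alpha n c (tau_comp rot_subst n m u)\<bar>)"
    if "n \<le> m" for m
  proof -
    obtain a where "a \<in> letters m" "[a] \<in> lang (level_shift letters rot_subst m)"
      using ex_letter_lang by blast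
    then show ?thesis
      using frac_morphism_letter[OF c that] by (intro SUP_upper2[of "[a]"]) auto
  qed
  show False
    using not_LIMSEQ_0_if_ge[OF ge] lim by (rule notE)
next
  let ?E = "\<lambda>c n. {dist_int (c n u - alpha * real (height rot_subst n u)) | a u.
      a \<in> letters (n + 2) \<and> prefix u (tau_comp rot_subst n (n + 2) [a])}"
  assume "\<exists>c. (\<forall>n. letter_coboundary (letters n) (level_shift letters rot_subst n) (c n)) \<and>
      summable (\<lambda>n. Max (?E c n))"
  then obtain c where c: "\<And>n. letter_coboundary (letters n) (level_shift letters rot_subst n) (c n)"
    and sum: "summable (\<lambda>n. Max (?E c n))"
    by blast
  have "1/4 \<le> Max (?E c n)" for n
  proof -
    let ?u = "tau_comp rot_subst n (n + 2) [0]"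
    have 0: "0 \<in> letters (n + 2)" by (simp add: letters_def)
    have "?u \<noteq> []"
      using length_tau_comp[of n "n + 2" "[0]"] width_pos[of n "n + 2"]
      by (metis le_add1 length_0_conv length_Cons list.size(3) mult_1 One_nat_def less_irrefl)
    \<comment> \<open>a prefix of length one already keeps the maximum away from 0\<close>
    then obtain b v where u: "?u = b # v"
      by (cases ?u) auto
    then have "b \<in> letters n"
      using lists_tau_comp_letter[of n "n + 2" 0] 0 by simp
    then have "1/4 \<le> dist_int (c n [b] - alpha * real (height rot_subst n [b]))"
      using dist_int_coboundary_height_letter[OF c[of n], of n b] by simp
    also have "\<dots> \<le> Max (?E c n)"
    proof (rule Max_ge)
      have "?E c n \<subseteq> (\<Union>a\<in>letters (n + 2).
          (\<lambda>u. dist_int (c n u - alpha * real (height rot_subst n u))) `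
            set (prefixes (tau_comp rot_subst n (n + 2) [a])))"
        by auto
      then show "finite (?E c n)"
        by (rule finite_subset) (simp add: letters_def)
      have "prefix [b] ?u" unfolding u by simp
      then show "dist_int (c n [b] - alpha * real (height rot_subst n [b])) \<in> ?E c n"
        using 0 by blast
    qed
    finally show ?thesis .
  qed
  then have "1/4 \<le> (0::real)"
    by (intro LIMSEQ_le_const[OF summable_LIMSEQ_zero[OF sum]]) blast
  then show False by simp
qed

end
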